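(* Let $A$ be a connected finite dimensional algebra over a field $k$. For any torsion class $\mathcal T\in\mathrm{tors}\,A$, the following are equivalent: (1) $\mathcal T$ is a left modular element of the lattice $\mathrm{tors}\,A$. (2) The set of bricks in $\mathcal T$ forms a successor-closed set of vertices of the brick quiver of $A$. Therefore, $\mathrm{tors}\,A$ is left modular (equivalently, extremal) if and only if there exists a maximal chain $\{\mathcal T_i\}_{i\in I}$ in $\mathrm{tors}\,A$ such that each $\mathcal T_i$ is a brick-splitting torsion class.
   Context: $\mathrm{mod}\,A$ is the category of finite dimensional $A$-modules. A torsion class is a full subcategory of $\mathrm{mod}\,A$ closed under isomorphisms, quotients and extensions; $\mathrm{tors}\,A$ is the complete lattice of torsion classes ordered by inclusion. A brick is a module whose endomorphism algebra is a division algebra; $\mathrm{brick}\,A$ is the set of isomorphism classes of bricks in $\mathrm{mod}\,A$. The brick quiver of $A$ has vertex set $\mathrm{brick}\,A$ and, for distinct $X,Y\in\mathrm{brick}\,A$, an arrow $X\to Y$ if $\mathrm{Hom}_A(X,Y)\neq0$. A set $S$ of vertices of a quiver is successor-closed if for every arrow $i\to j$, $i\in S$ implies $j\in S$. With $\mathcal T^\perp=\{X\in\mathrm{mod}\,A\mid\mathrm{Hom}_A(T,X)=0\ \forall T\in\mathcal T\}$, a torsion class $\mathcal T$ is brick-splitting if every brick in $\mathrm{mod}\,A$ belongs to $\mathcal T$ or to $\mathcal T^\perp$. For a complete lattice $L$: $x\in L$ is left modular if $(y\vee x)\wedge z=y\vee(x\wedge z)$ for all $y\leq z$; $L$ is left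 modular if it has an inclusion-maximal chain of left modular elements. $\mathrm{JI}^c(L)$ is the set of completely join-irreducible elements ($x\neq\bigvee\emptyset$ with $x\neq\bigvee S$ for all $S\subseteq\{y\mid y<x\}$), with $x_*:=\bigvee\{y\mid y<x\}$; $\mathrm{MI}^c(L)$ is the dual notion. The lattice $L=\mathrm{tors}\,A$ is known to be weakly atomic, completely semidistributive, and a well-separated $\kappa$-lattice; in particular $\kappa:\mathrm{JI}^c(L)\to\mathrm{MI}^c(L)$, $\kappa(j)=\max\{x\mid x\wedge j=j_*\}$, is a well-defined bijection. $L$ is extremal if it has a maximal chain $\mathcal X$ such that: for all $x\in\mathcal X$ and $j\in\mathrm{JI}^c(L)$ with $j\not\leq x$ we have $x\leq\kappa(j)$; and whenever $x\lessdot y$ is a cover relation with $x,y\in\mathcal X$, there is a unique $j\in\mathrm{JI}^c(L)$ with $j\leq y$, $j\not\leq x$, a unique $m\in\mathrm{MI}^c(L)$ with $x\leq m$, $y\not\leq m$, and $\kappa(j)=m$. *)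

theory Defs
  imports
    "HOL-Algebra.Complete_Lattice"
    "Jordan_Normal_Form.Missing_VectorSpace"
    "Graph_Theory.Pair_Digraph"
begin

section \<open>Finite dimensional algebras and their modules\<close>

text \<open>
  The locales \<^locale>\<open>algebra\<close> and \<^locale>\<open>module\<close> of HOL-Algebra demand a commutative
  algebra and a commutative base ring, respectively; the two locales below are
  their noncommutative counterparts.
\<close>

locale fd_algebra = vectorspace K A + A?: ring A
  for K :: "('k, 'c) ring_scheme" and A :: "('k, 'a, 'd) module_scheme" (structure) +
  assumes smult_mult_left:
      "\<lbrakk>c \<in> carrier K; x \<in> carrier A; y \<in> carrier A\<rbrakk>
        \<Longrightarrow> (c \<odot>\<^bsub>A\<^esub> x) \<otimes>\<^bsub>A\<^esub> y = c \<odot>\<^bsub>A\<^esub> (x \<otimes>\<^bsub>A\<^esub> y)"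
    and smult_mult_right:
      "\<lbrakk>c \<in> carrier K; x \<in> carrier A; y \<in> carrier A\<rbrakk>
        \<Longrightarrow> x \<otimes>\<^bsub>A\<^esub> (c \<odot>\<^bsub>A\<^esub> y) = c \<odot>\<^bsub>A\<^esub> (x \<otimes>\<^bsub>A\<^esub> y)"
    and finite_dimensional: "vectorspace.fin_dim K A"

text \<open>
  A direct product decomposition of an algebra corresponds to a central idempotent.
  The zero algebra does not count as connected.
\<close>

definition connected_algebra :: "('a, 'd) ring_scheme \<Rightarrow> bool" where
  "connected_algebra A \<longleftrightarrow>
     \<one>\<^bsub>A\<^esub> \<noteq> \<zero>\<^bsub>A\<^esub> \<and>
     (\<forall>e \<in> carrier A.
        e \<otimes>\<^bsub>A\<^esub> e = e \<and> (\<forall>a \<in> carrier A. e \<otimes>\<^bsub>A\<^esub> a = a \<otimes>\<^bsub>A\<^esub> e)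
          \<longrightarrow> e = \<zero>\<^bsub>A\<^esub> \<or> e = \<one>\<^bsub>A\<^esub>)"

text \<open>
  As for \<^locale>\<open>module\<close>, the fields \<^const>\<open>monoid.mult\<close> and \<^const>\<open>one\<close> of the record \<open>M\<close> play no role.
\<close>

locale left_module = A?: ring A + M?: abelian_group M
  for A :: "('a, 'd) ring_scheme" (structure) and M :: "('a, 'v, 'm) module_scheme" (structure) +
  assumes act_closed:
      "\<lbrakk>a \<in> carrier A; x \<in> carrier M\<rbrakk> \<Longrightarrow> a \<odot>\<^bsub>M\<^esub> x \<in> carrier M"
    and act_l_distr:
      "\<lbrakk>a \<in> carrier A; b \<in> carrier A; x \<in> carrier M\<rbrakk>
        \<Longrightarrow> (a \<oplus>\<^bsub>A\<^esub> b) \<odot>\<^bsub>M\<^esub> x = (a \<odot>\<^bsub>M\<^esub> x) \<oplus>\<^bsub>M\<^esub> (b \<odot>\<^bsub>M\<^esub> x)"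
    and act_r_distr:
      "\<lbrakk>a \<in> carrier A; x \<in> carrier M; y \<in> carrier M\<rbrakk>
        \<Longrightarrow> a \<odot>\<^bsub>M\<^esub> (x \<oplus>\<^bsub>M\<^esub> y) = (a \<odot>\<^bsub>M\<^esub> x) \<oplus>\<^bsub>M\<^esub> (a \<odot>\<^bsub>M\<^esub> y)"
    and act_assoc:
      "\<lbrakk>a \<in> carrier A; b \<in> carrier A; x \<in> carrier M\<rbrakk>
        \<Longrightarrow> (a \<otimes>\<^bsub>A\<^esub> b) \<odot>\<^bsub>M\<^esub> x = a \<odot>\<^bsub>M\<^esub> (b \<odot>\<^bsub>M\<^esub> x)"
    and act_one: "x \<in> carrier M \<Longrightarrow> \<one>\<^bsub>A\<^esub> \<odot>\<^bsub>M\<^esub> x = x"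

text \<open>The vector space underlying an \<open>A\<close>-module: scalars act through \<open>c \<mapsto> c \<cdot> 1\<close>.\<close>

definition underlying_space ::
  "('k, 'a, 'd) module_scheme \<Rightarrow> ('a, 'v, 'm) module_scheme \<Rightarrow> ('k, 'v) module" where
  "underlying_space A M =
     \<lparr>carrier = carrier M, monoid.mult = monoid.mult M, one = one M, zero = zero M, add = add M,
      smult = (\<lambda>c x. (c \<odot>\<^bsub>A\<^esub> \<one>\<^bsub>A\<^esub>) \<odot>\<^bsub>M\<^esub> x)\<rparr>"

text \<open>
  The objects of \<open>mod A\<close>, with left modules.  The underlying set of a module ranges over all subsets
  of the type \<open>nat \<Rightarrow> 'k\<close>, and the module structure on it is arbitrary.  This type
  contains a copy of \<open>K\<^sup>n\<close> for every \<open>n\<close>, so every finite dimensional \<open>A\<close>-module is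
  isomorphic to an object of \<open>mod A\<close>.
\<close>

definition mod_cat ::
  "('k, 'c) ring_scheme \<Rightarrow> ('k, 'a, 'd) module_scheme \<Rightarrow> ('a, nat \<Rightarrow> 'k) module set" where
  "mod_cat K A = {M. left_module A M \<and> vectorspace.fin_dim K (underlying_space A M)}"

text \<open>
  Homomorphisms are made extensional, i.e. \<^const>\<open>undefined\<close> off the carrier, so that
  two of them are equal as soon as they agree on the carrier.
\<close>

definition Hom ::
  "('a, 'd) ring_scheme \<Rightarrow> ('a, 'v) module \<Rightarrow> ('a, 'v) module \<Rightarrow> ('v \<Rightarrow> 'v) set" where
  "Hom A M N = LinearCombinations.module_hom A M N \<inter> extensional (carrier M)"

definition zero_hom :: "('a, 'v) module \<Rightarrow> ('a, 'v) module \<Rightarrow> 'v \<Rightarrow> 'v" where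
  "zero_hom M N = (\<lambda>x \<in> carrier M. \<zero>\<^bsub>N\<^esub>)"

definition module_iso ::
  "('a, 'd) ring_scheme \<Rightarrow> ('a, 'v) module \<Rightarrow> ('a, 'v) module \<Rightarrow> bool" where
  "module_iso A M N \<longleftrightarrow> (\<exists>f \<in> Hom A M N. bij_betw f (carrier M) (carrier N))"

definition short_exact ::
  "('a, 'd) ring_scheme \<Rightarrow> ('a, 'v) module \<Rightarrow> ('v \<Rightarrow> 'v) \<Rightarrow> ('a, 'v) module
     \<Rightarrow> ('v \<Rightarrow> 'v) \<Rightarrow> ('a, 'v) module \<Rightarrow> bool" where
  "short_exact A X f Y g Z \<longleftrightarrow>
     f \<in> Hom A X Y \<and> g \<in> Hom A Y Z \<and>
     inj_on f (carrier X) \<and>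
     f ` carrier X = {y \<in> carrier Y. g y = \<zero>\<^bsub>Z\<^esub>} \<and>
     g ` carrier Y = carrier Z"


section \<open>Torsion classes\<close>

text \<open>
  A full subcategory is given by its set of objects.  It is required to be nonempty;
  closure under quotients then puts the zero module into every torsion class.
\<close>

definition torsion_class ::
  "('k, 'c) ring_scheme \<Rightarrow> ('k, 'a, 'd) module_scheme
     \<Rightarrow> ('a, nat \<Rightarrow> 'k) module set \<Rightarrow> bool" where
  "torsion_class K A \<T> \<longleftrightarrow>
     \<T> \<subseteq> mod_cat K A \<and> \<T> \<noteq> {} \<and>
     (\<forall>M \<in> \<T>. \<forall>N \<in> mod_cat K A. module_iso A M N \<longrightarrow> N \<in> \<T>) \<and>
     (\<forall>M \<in> \<T>. \<forall>N \<in> mod_cat K A. (\<exists>g \<in> Hom A M N. g ` carrier M = carrier N) \<longrightarrow> N \<in> \<T>) \<and>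
     (\<forall>X \<in> \<T>. \<forall>Z \<in> \<T>. \<forall>Y \<in> mod_cat K A. (\<exists>f g. short_exact A X f Y g Z) \<longrightarrow> Y \<in> \<T>)"

definition tors ::
  "('k, 'c) ring_scheme \<Rightarrow> ('k, 'a, 'd) module_scheme
     \<Rightarrow> ('a, nat \<Rightarrow> 'k) module set gorder" where
  "tors K A = \<lparr>carrier = {\<T>. torsion_class K A \<T>}, eq = (=), le = (\<subseteq>)\<rparr>"

definition right_perp ::
  "('k, 'c) ring_scheme \<Rightarrow> ('k, 'a, 'd) module_scheme
     \<Rightarrow> ('a, nat \<Rightarrow> 'k) module set \<Rightarrow> ('a, nat \<Rightarrow> 'k) module set" where
  "right_perp K A \<T> = {X \<in> mod_cat K A. \<forall>T \<in> \<T>. Hom A T X = {zero_hom T X}}"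


section \<open>Bricks and the brick quiver\<close>

definition endomorphism_ring ::
  "('a, 'd) ring_scheme \<Rightarrow> ('a, 'v) module \<Rightarrow> ('v \<Rightarrow> 'v) ring" where
  "endomorphism_ring A M =
     \<lparr>carrier = Hom A M M,
      monoid.mult = compose (carrier M),
      one = (\<lambda>x \<in> carrier M. x),
      zero = zero_hom M M,
      add = (\<lambda>f g. \<lambda>x \<in> carrier M. f x \<oplus>\<^bsub>M\<^esub> g x)\<rparr>"

text \<open>Since \<open>1\<close> is a unit, the last equation entails \<open>1 \<noteq> 0\<close>.\<close>

definition division_ring :: "('r, 'e) ring_scheme \<Rightarrow> bool" where
  "division_ring R \<longleftrightarrow> ring R \<and> Units R = carrier R - {\<zero>\<^bsub>R\<^esub>}"

definition is_brick :: "('a, 'd) ring_scheme \<Rightarrow> ('a, 'v) module \<Rightarrow> bool" where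
  "is_brick A M \<longleftrightarrow> division_ring (endomorphism_ring A M)"

definition iso_class ::
  "('k, 'c) ring_scheme \<Rightarrow> ('k, 'a, 'd) module_scheme
     \<Rightarrow> ('a, nat \<Rightarrow> 'k) module \<Rightarrow> ('a, nat \<Rightarrow> 'k) module set" where
  "iso_class K A M = {N \<in> mod_cat K A. module_iso A M N}"

definition brick ::
  "('k, 'c) ring_scheme \<Rightarrow> ('k, 'a, 'd) module_scheme
     \<Rightarrow> ('a, nat \<Rightarrow> 'k) module set set" where
  "brick K A = iso_class K A ` {M \<in> mod_cat K A. is_brick A M}"

definition brick_quiver ::
  "('k, 'c) ring_scheme \<Rightarrow> ('k, 'a, 'd) module_scheme
     \<Rightarrow> ('a, nat \<Rightarrow> 'k) module set pair_pre_digraph" where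
  "brick_quiver K A =
     \<lparr>pverts = brick K A,
      parcs = {(X, Y). X \<in> brick K A \<and> Y \<in> brick K A \<and> X \<noteq> Y \<and>
                (\<exists>M \<in> X. \<exists>N \<in> Y. Hom A M N \<noteq> {zero_hom M N})}\<rparr>"

definition successor_closed :: "'v pair_pre_digraph \<Rightarrow> 'v set \<Rightarrow> bool" where
  "successor_closed Q S \<longleftrightarrow>
     S \<subseteq> pverts Q \<and> (\<forall>i j. (i, j) \<in> parcs Q \<and> i \<in> S \<longrightarrow> j \<in> S)"

definition bricks_in ::
  "('k, 'c) ring_scheme \<Rightarrow> ('k, 'a, 'd) module_scheme
     \<Rightarrow> ('a, nat \<Rightarrow> 'k) module set \<Rightarrow> ('a, nat \<Rightarrow> 'k) module set set" where
  "bricks_in K A \<T> = {X \<in> brick K A. X \<subseteq> \<T>}"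

definition brick_splitting ::
  "('k, 'c) ring_scheme \<Rightarrow> ('k, 'a, 'd) module_scheme
     \<Rightarrow> ('a, nat \<Rightarrow> 'k) module set \<Rightarrow> bool" where
  "brick_splitting K A \<T> \<longleftrightarrow>
     torsion_class K A \<T> \<and>
     (\<forall>B \<in> mod_cat K A. is_brick A B \<longrightarrow> B \<in> \<T> \<or> B \<in> right_perp K A \<T>)"


section \<open>Left modular and extremal lattices\<close>

definition maximal_chain :: "('b, 'e) gorder_scheme \<Rightarrow> 'b set \<Rightarrow> bool" where
  "maximal_chain L C \<longleftrightarrow> pred_on.maxchain (carrier L) (lless L) C"

definition covers :: "('b, 'e) gorder_scheme \<Rightarrow> 'b \<Rightarrow> 'b \<Rightarrow> bool" where
  "covers L x y \<longleftrightarrow>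
     x \<sqsubset>\<^bsub>L\<^esub> y \<and> \<not> (\<exists>z \<in> carrier L. x \<sqsubset>\<^bsub>L\<^esub> z \<and> z \<sqsubset>\<^bsub>L\<^esub> y)"

definition left_modular_element :: "('b, 'e) gorder_scheme \<Rightarrow> 'b \<Rightarrow> bool" where
  "left_modular_element L x \<longleftrightarrow>
     x \<in> carrier L \<and>
     (\<forall>y \<in> carrier L. \<forall>z \<in> carrier L. y \<sqsubseteq>\<^bsub>L\<^esub> z \<longrightarrow>
        (y \<squnion>\<^bsub>L\<^esub> x) \<sqinter>\<^bsub>L\<^esub> z = y \<squnion>\<^bsub>L\<^esub> (x \<sqinter>\<^bsub>L\<^esub> z))"

definition left_modular :: "('b, 'e) gorder_scheme \<Rightarrow> bool" where
  "left_modular L \<longleftrightarrow>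
     (\<exists>C. maximal_chain L C \<and> (\<forall>x \<in> C. left_modular_element L x))"

definition JIc :: "('b, 'e) gorder_scheme \<Rightarrow> 'b set" where
  "JIc L = {x \<in> carrier L. x \<noteq> \<Squnion>\<^bsub>L\<^esub>{} \<and>
     (\<forall>S. S \<subseteq> {y \<in> carrier L. y \<sqsubset>\<^bsub>L\<^esub> x} \<longrightarrow> x \<noteq> \<Squnion>\<^bsub>L\<^esub>S)}"

definition MIc :: "('b, 'e) gorder_scheme \<Rightarrow> 'b set" where
  "MIc L = {x \<in> carrier L. x \<noteq> \<Sqinter>\<^bsub>L\<^esub>{} \<and>
     (\<forall>S. S \<subseteq> {y \<in> carrier L. x \<sqsubset>\<^bsub>L\<^esub> y} \<longrightarrow> x \<noteq> \<Sqinter>\<^bsub>L\<^esub>S)}"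

definition lower_star :: "('b, 'e) gorder_scheme \<Rightarrow> 'b \<Rightarrow> 'b" where
  "lower_star L x = \<Squnion>\<^bsub>L\<^esub>{y \<in> carrier L. y \<sqsubset>\<^bsub>L\<^esub> x}"

definition kappa :: "('b, 'e) gorder_scheme \<Rightarrow> 'b \<Rightarrow> 'b" where
  "kappa L j =
     (THE x. greatest L x {x \<in> carrier L. x \<sqinter>\<^bsub>L\<^esub> j = lower_star L j})"

definition extremal :: "('b, 'e) gorder_scheme \<Rightarrow> bool" where
  "extremal L \<longleftrightarrow>
     (\<exists>C. maximal_chain L C \<and>
        (\<forall>x \<in> C. \<forall>j \<in> JIc L. \<not> j \<sqsubseteq>\<^bsub>L\<^esub> x \<longrightarrow> x \<sqsubseteq>\<^bsub>L\<^esub> kappa L j) \<and>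
        (\<forall>x \<in> C. \<forall>y \<in> C. covers L x y \<longrightarrow>
           (\<exists>j m. {j' \<in> JIc L. j' \<sqsubseteq>\<^bsub>L\<^esub> y \<and> \<not> j' \<sqsubseteq>\<^bsub>L\<^esub> x} = {j} \<and>
                  {m' \<in> MIc L. x \<sqsubseteq>\<^bsub>L\<^esub> m' \<and> \<not> y \<sqsubseteq>\<^bsub>L\<^esub> m'} = {m} \<and>
                  kappa L j = m)))"

end

theory Submission
  imports Defs
begin

text \<open>
  Everything rests on one observation: in a class \<open>C\<close> of modules that contains, with every module
  \<open>X\<close>, the images of the endomorphisms of \<open>X\<close>, a nonzero module of least dimension is a brick
  (\<open>brick_of_minimal_dimension\<close>), because a nonzero endomorphism has an image in \<open>C\<close>, which cannot
  be smaller than the module.  Torsion classes are closed under quotients and right perpendicular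
  classes under submodules, so there are many such classes \<open>C\<close>.  In particular, if \<open>\<T>\<^sub>1\<close> is
  not contained in \<open>\<T>\<^sub>2\<close>, then some brick lies in \<open>\<T>\<^sub>1 \<inter> \<T>\<^sub>2\<^sup>\<bottom>\<close>
  (\<open>brick_of_not_subset\<close>); inclusions of torsion classes can therefore be tested on bricks.

  For a brick \<open>B\<close> write \<open>T(B)\<close> for the torsion class generated by \<open>B\<close> and \<open>\<^sup>\<bottom>B\<close> for the torsion
  class of all \<open>X\<close> with \<open>Hom(X, B) = 0\<close>.  A homomorphism from a member of \<open>T(B)\<close> to \<open>B\<close> is zero
  or surjective (\<open>mem_generated_zero_or_surj\<close>), and a proper quotient of \<open>B\<close> lies in \<open>\<^sup>\<bottom>B\<close>
  (\<open>brick_quotient_orthogonal\<close>).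

  Left modularity of \<open>\<T>\<close> is equivalent to \<open>\<T>\<close> being brick-splitting.  If \<open>\<T>\<close> is
  brick-splitting and \<open>\<Y> \<subseteq> \<Z>\<close>, a failure of \<open>(\<Y> \<squnion> \<T>) \<sqinter> \<Z> \<subseteq> \<Y> \<squnion> (\<T> \<sqinter> \<Z>)\<close> is witnessed by a brick \<open>B\<close>
  on the left that is perpendicular to the right; whether \<open>B\<close> is in \<open>\<T>\<close> or in \<open>\<T>\<^sup>\<bottom>\<close>, this
  is absurd.  If \<open>B\<close> is a brick that is neither in \<open>\<T>\<close> nor in \<open>\<T>\<^sup>\<bottom>\<close>, it has a nonzero
  submodule \<open>N\<close> in \<open>\<T>\<close>, and the modular law fails for \<open>\<Y> = T(B/N)\<close> and \<open>\<Z> = T(B)\<close>: the left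
  hand side contains \<open>B\<close>, and the right hand side is contained in \<open>\<^sup>\<bottom>B\<close>.  Brick-splitting is in turn
  the same as successor-closedness, since a brick with a nonzero homomorphism from \<open>\<T>\<close> receives
  one from a brick in \<open>\<T>\<close> (\<open>torsion_brick_submodule\<close>).

  As for extremality, the completely join-irreducible elements are the classes \<open>T(B)\<close>, the
  completely meet-irreducible ones the classes \<open>\<^sup>\<bottom>B\<close>, and \<open>\<kappa>(T(B)) = \<^sup>\<bottom>B\<close>.  Hence the condition
  on \<open>\<kappa>\<close> in the definition of extremality says that the members of the chain are
  brick-splitting (\<open>brick_splitting_iff_kappa\<close>).  The condition on covers then holds
  automatically: for a cover \<open>\<T> \<subset> \<U>\<close> the bricks in \<open>\<U> \<inter> \<T>\<^sup>\<bottom>\<close> form one isomorphism class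
  (\<open>brick_of_cover_unique\<close>), and for brick-splitting \<open>\<T>\<close> and \<open>\<U>\<close> these are both the bricks
  \<open>B\<close> with \<open>T(B) \<subseteq> \<U>\<close>, not \<open>T(B) \<subseteq> \<T>\<close> and those with \<open>\<T> \<subseteq> \<^sup>\<bottom>B\<close>, not \<open>\<U> \<subseteq> \<^sup>\<bottom>B\<close>.
\<close>

section \<open>Homomorphisms, submodules and quotients\<close>

lemma image_preimage_eq: "T \<subseteq> f ` S \<Longrightarrow> f ` {x \<in> S. f x \<in> T} = T"
  by auto

lemma HomI:
  assumes "\<And>x. x \<in> carrier M \<Longrightarrow> f x \<in> carrier N"
    and "\<And>x y. \<lbrakk>x \<in> carrier M; y \<in> carrier M\<rbrakk> \<Longrightarrow> f (x \<oplus>\<^bsub>M\<^esub> y) = f x \<oplus>\<^bsub>N\<^esub> f y"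
    and "\<And>a x. \<lbrakk>a \<in> carrier A; x \<in> carrier M\<rbrakk> \<Longrightarrow> f (a \<odot>\<^bsub>M\<^esub> x) = a \<odot>\<^bsub>N\<^esub> f x"
    and "f \<in> extensional (carrier M)"
  shows "f \<in> Hom A M N"
  using assms by (auto simp: Hom_def LinearCombinations.module_hom_def)

lemma
  assumes "f \<in> Hom A M N"
  shows Hom_closed: "x \<in> carrier M \<Longrightarrow> f x \<in> carrier N"
    and Hom_add: "\<lbrakk>x \<in> carrier M; y \<in> carrier M\<rbrakk> \<Longrightarrow> f (x \<oplus>\<^bsub>M\<^esub> y) = f x \<oplus>\<^bsub>N\<^esub> f y"
    and Hom_smult: "\<lbrakk>a \<in> carrier A; x \<in> carrier M\<rbrakk> \<Longrightarrow> f (a \<odot>\<^bsub>M\<^esub> x) = a \<odot>\<^bsub>N\<^esub> f x"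
    and Hom_extensional: "f \<in> extensional (carrier M)"
  using assms by (auto simp: Hom_def LinearCombinations.module_hom_def)

lemma Hom_eqI:
  assumes "f \<in> Hom A M N" "g \<in> Hom A M N'" "\<And>x. x \<in> carrier M \<Longrightarrow> f x = g x"
  shows "f = g"
  using assms by (blast intro: extensionalityI Hom_extensional)

lemma Hom_zero:
  assumes "left_module A M" "left_module A N" "f \<in> Hom A M N"
  shows "f \<zero>\<^bsub>M\<^esub> = \<zero>\<^bsub>N\<^esub>"
proof -
  interpret M: left_module A M by fact
  interpret N: left_module A N by fact
  have c: "f \<zero>\<^bsub>M\<^esub> \<in> carrier N"
    using Hom_closed[OF assms(3)] by simp
  have "f \<zero>\<^bsub>M\<^esub> \<oplus>\<^bsub>N\<^esub> f \<zero>\<^bsub>M\<^esub> = f \<zero>\<^bsub>M\<^esub>"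
    using Hom_add[OF assms(3), of "\<zero>\<^bsub>M\<^esub>" "\<zero>\<^bsub>M\<^esub>"] by simp
  then show ?thesis
    using c by (metis N.M.add.l_cancel_one)
qed

lemma Hom_minus:
  assumes "left_module A M" "left_module A N" "f \<in> Hom A M N"
    and x: "x \<in> carrier M" and y: "y \<in> carrier M"
  shows "f (x \<ominus>\<^bsub>M\<^esub> y) = f x \<ominus>\<^bsub>N\<^esub> f y"
proof -
  interpret M: left_module A M by fact
  interpret N: left_module A N by fact
  have c: "f x \<in> carrier N" "f y \<in> carrier N" "f (x \<ominus>\<^bsub>M\<^esub> y) \<in> carrier N"
    using Hom_closed[OF assms(3)] x y by simp_all
  have "f (x \<ominus>\<^bsub>M\<^esub> y) \<oplus>\<^bsub>N\<^esub> f y = f ((x \<ominus>\<^bsub>M\<^esub> y) \<oplus>\<^bsub>M\<^esub> y)"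
    using Hom_add[OF assms(3)] x y by simp
  also have "(x \<ominus>\<^bsub>M\<^esub> y) \<oplus>\<^bsub>M\<^esub> y = x"
    using x y by (simp add: a_minus_def M.M.a_assoc M.M.l_neg)
  finally show ?thesis
    using c by (metis N.M.add.inv_solve_right a_minus_def)
qed

lemma minus_eq_zero_iff:
  assumes "abelian_group M" "x \<in> carrier M" "y \<in> carrier M"
  shows "x \<ominus>\<^bsub>M\<^esub> y = \<zero>\<^bsub>M\<^esub> \<longleftrightarrow> x = y"
proof -
  interpret abelian_group M by fact
  show ?thesis
    using assms(2,3) by (metis a_minus_def add.inv_solve_right' l_zero minus_closed zero_closed)
qed

lemma Hom_inj_on_iff:
  assumes "left_module A M" "left_module A N" "f \<in> Hom A M N"
  shows "inj_on f (carrier M) \<longleftrightarrow> (\<forall>x \<in> carrier M. f x = \<zero>\<^bsub>N\<^esub> \<longrightarrow> x = \<zero>\<^bsub>M\<^esub>)"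
proof -
  interpret M: left_module A M by fact
  interpret N: left_module A N by fact
  show ?thesis
  proof
    assume "inj_on f (carrier M)"
    then show "\<forall>x \<in> carrier M. f x = \<zero>\<^bsub>N\<^esub> \<longrightarrow> x = \<zero>\<^bsub>M\<^esub>"
      using Hom_zero[OF assms] by (metis M.M.zero_closed inj_onD)
  next
    assume *: "\<forall>x \<in> carrier M. f x = \<zero>\<^bsub>N\<^esub> \<longrightarrow> x = \<zero>\<^bsub>M\<^esub>"
    show "inj_on f (carrier M)"
    proof (rule inj_onI)
      fix x y assume xy: "x \<in> carrier M" "y \<in> carrier M" "f x = f y"
      then have "f (x \<ominus>\<^bsub>M\<^esub> y) = \<zero>\<^bsub>N\<^esub>"
        using Hom_minus[OF assms] Hom_closed[OF assms(3)]
        by (simp add: minus_eq_zero_iff[OF N.M.abelian_group_axioms])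
      then have "x \<ominus>\<^bsub>M\<^esub> y = \<zero>\<^bsub>M\<^esub>"
        using * xy by simp
      then show "x = y"
        using xy minus_eq_zero_iff[OF M.M.abelian_group_axioms] by blast
    qed
  qed
qed

lemma Hom_compose:
  assumes "left_module A M" "f \<in> Hom A M N" "g \<in> Hom A N P"
  shows "compose (carrier M) g f \<in> Hom A M P"
proof -
  interpret M: left_module A M by fact
  show ?thesis
    by (rule HomI)
      (simp_all add: compose_def M.act_closed Hom_closed[OF assms(2)] Hom_add[OF assms(2)]
        Hom_smult[OF assms(2)] Hom_closed[OF assms(3)] Hom_add[OF assms(3)] Hom_smult[OF assms(3)])
qed

lemma compose_Hom_apply: "x \<in> carrier M \<Longrightarrow> compose (carrier M) g f x = g (f x)"
  by (simp add: compose_def)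

lemma id_Hom:
  assumes "left_module A M"
  shows "(\<lambda>x \<in> carrier M. x) \<in> Hom A M M"
proof -
  interpret M: left_module A M by fact
  show ?thesis
    by (rule HomI) (auto simp: M.act_closed)
qed

lemma zero_smult:
  assumes "left_module A M" "a \<in> carrier A"
  shows "a \<odot>\<^bsub>M\<^esub> \<zero>\<^bsub>M\<^esub> = \<zero>\<^bsub>M\<^esub>"
proof -
  interpret M: left_module A M by fact
  have c: "a \<odot>\<^bsub>M\<^esub> \<zero>\<^bsub>M\<^esub> \<in> carrier M"
    using assms(2) by (simp add: M.act_closed)
  have "a \<odot>\<^bsub>M\<^esub> \<zero>\<^bsub>M\<^esub> \<oplus>\<^bsub>M\<^esub> a \<odot>\<^bsub>M\<^esub> \<zero>\<^bsub>M\<^esub> = a \<odot>\<^bsub>M\<^esub> \<zero>\<^bsub>M\<^esub>"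
    using assms(2) M.act_r_distr[of a "\<zero>\<^bsub>M\<^esub>" "\<zero>\<^bsub>M\<^esub>"] by simp
  then show ?thesis
    using c by (metis M.M.add.l_cancel_one)
qed

lemma smult_minus_one:
  assumes "left_module A M" "x \<in> carrier M"
  shows "(\<ominus>\<^bsub>A\<^esub> \<one>\<^bsub>A\<^esub>) \<odot>\<^bsub>M\<^esub> x = \<ominus>\<^bsub>M\<^esub> x"
proof -
  interpret M: left_module A M by fact
  have c: "\<zero>\<^bsub>A\<^esub> \<odot>\<^bsub>M\<^esub> x \<in> carrier M"
    using assms(2) by (simp add: M.act_closed)
  have "\<zero>\<^bsub>A\<^esub> \<odot>\<^bsub>M\<^esub> x \<oplus>\<^bsub>M\<^esub> \<zero>\<^bsub>A\<^esub> \<odot>\<^bsub>M\<^esub> x = \<zero>\<^bsub>A\<^esub> \<odot>\<^bsub>M\<^esub> x"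
    using assms(2) M.act_l_distr[of "\<zero>\<^bsub>A\<^esub>" "\<zero>\<^bsub>A\<^esub>" x] by simp
  then have z: "\<zero>\<^bsub>A\<^esub> \<odot>\<^bsub>M\<^esub> x = \<zero>\<^bsub>M\<^esub>"
    using c by (metis M.M.add.l_cancel_one)
  have "(\<ominus>\<^bsub>A\<^esub> \<one>\<^bsub>A\<^esub>) \<odot>\<^bsub>M\<^esub> x \<oplus>\<^bsub>M\<^esub> x = (\<ominus>\<^bsub>A\<^esub> \<one>\<^bsub>A\<^esub> \<oplus>\<^bsub>A\<^esub> \<one>\<^bsub>A\<^esub>) \<odot>\<^bsub>M\<^esub> x"
    using assms(2) by (simp add: M.act_l_distr M.act_one del: M.A.l_neg)
  also have "\<dots> = \<zero>\<^bsub>M\<^esub>"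
    by (simp add: z M.A.l_neg)
  finally show ?thesis
    using assms(2) by (simp add: M.M.minus_equality M.act_closed)
qed

lemma zero_hom_Hom:
  assumes "left_module A M" "left_module A N"
  shows "zero_hom M N \<in> Hom A M N"
proof -
  interpret M: left_module A M by fact
  interpret N: left_module A N by fact
  show ?thesis
    unfolding zero_hom_def
    by (rule HomI) (auto simp: M.act_closed zero_smult[OF assms(2)])
qed

lemma Hom_inverse:
  assumes "left_module A M" "left_module A N" "f \<in> Hom A M N"
    and bij: "bij_betw f (carrier M) (carrier N)"
  obtains g where "g \<in> Hom A N M" "bij_betw g (carrier N) (carrier M)"
    "\<And>x. x \<in> carrier M \<Longrightarrow> g (f x) = x" "\<And>y. y \<in> carrier N \<Longrightarrow> f (g y) = y"
proof -
  interpret M: left_module A M by fact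
  interpret N: left_module A N by fact
  define g where "g = (\<lambda>y \<in> carrier N. inv_into (carrier M) f y)"
  have gc: "g y \<in> carrier M" and fg: "f (g y) = y" if "y \<in> carrier N" for y
    using that bij by (auto simp: g_def bij_betw_def intro: inv_into_into f_inv_into_f)
  have gf: "g (f x) = x" if "x \<in> carrier M" for x
    using that bij Hom_closed[OF assms(3)] by (simp add: g_def bij_betw_def)
  have bij': "bij_betw g (carrier N) (carrier M)"
    using bij bij_betw_cong[of "carrier N" g "inv_into (carrier M) f"]
    by (simp add: g_def bij_betw_inv_into)
  have "g \<in> Hom A N M"
  proof (rule HomI)
    fix x y assume xy: "x \<in> carrier N" "y \<in> carrier N"
    then have "f (g x \<oplus>\<^bsub>M\<^esub> g y) = x \<oplus>\<^bsub>N\<^esub> y"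
      by (simp add: Hom_add[OF assms(3)] gc fg)
    then show "g (x \<oplus>\<^bsub>N\<^esub> y) = g x \<oplus>\<^bsub>M\<^esub> g y"
      using gf xy gc by (metis M.M.add.m_closed)
  next
    fix a x assume ax: "a \<in> carrier A" "x \<in> carrier N"
    then have "f (a \<odot>\<^bsub>M\<^esub> g x) = a \<odot>\<^bsub>N\<^esub> x"
      by (simp add: Hom_smult[OF assms(3)] gc fg)
    then show "g (a \<odot>\<^bsub>N\<^esub> x) = a \<odot>\<^bsub>M\<^esub> g x"
      using gf ax gc by (metis M.act_closed)
  qed (auto simp: gc, simp add: g_def)
  with bij' gf fg that show thesis by blast
qed

text \<open>
  The condition \<open>Hom(M, N) = 0\<close>, stated elementwise so that the extensional zero map need not be
  mentioned; \<open>orthogonal_iff\<close> links the two forms.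
\<close>

definition orthogonal :: "('a, 'd) ring_scheme \<Rightarrow> ('a, 'v) module \<Rightarrow> ('a, 'v) module \<Rightarrow> bool" where
  "orthogonal A M N \<longleftrightarrow> (\<forall>f \<in> Hom A M N. \<forall>x \<in> carrier M. f x = \<zero>\<^bsub>N\<^esub>)"

lemma orthogonal_iff:
  assumes "left_module A M" "left_module A N"
  shows "Hom A M N = {zero_hom M N} \<longleftrightarrow> orthogonal A M N"
proof
  assume "Hom A M N = {zero_hom M N}"
  then show "orthogonal A M N"
    by (simp add: orthogonal_def zero_hom_def)
next
  assume o: "orthogonal A M N"
  have "f = zero_hom M N" if "f \<in> Hom A M N" for f
    using that o by (intro Hom_eqI[OF that zero_hom_Hom[OF assms]]) (auto simp: orthogonal_def zero_hom_def)
  then show "Hom A M N = {zero_hom M N}"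
    using zero_hom_Hom[OF assms] by blast
qed

lemma orthogonal_sub:
  assumes "left_module A M" "left_module A Y" "left_module A X"
    and i: "i \<in> Hom A Y X" "inj_on i (carrier Y)" and o: "orthogonal A M X"
  shows "orthogonal A M Y"
  unfolding orthogonal_def
proof (intro ballI)
  fix f x assume f: "f \<in> Hom A M Y" and x: "x \<in> carrier M"
  have "compose (carrier M) i f x = \<zero>\<^bsub>X\<^esub>"
    using o Hom_compose[OF assms(1) f i(1)] x by (simp add: orthogonal_def)
  then have "i (f x) = \<zero>\<^bsub>X\<^esub>"
    using x by (simp add: compose_def)
  then show "f x = \<zero>\<^bsub>Y\<^esub>"
    using i(2) Hom_inj_on_iff[OF assms(2,3) i(1)] Hom_closed[OF f x] by blast
qed

definition submodule_set :: "('a, 'd) ring_scheme \<Rightarrow> ('a, 'v) module \<Rightarrow> 'v set \<Rightarrow> bool" where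
  "submodule_set A M N \<longleftrightarrow> N \<subseteq> carrier M \<and> \<zero>\<^bsub>M\<^esub> \<in> N \<and>
     (\<forall>x \<in> N. \<forall>y \<in> N. x \<oplus>\<^bsub>M\<^esub> y \<in> N) \<and> (\<forall>a \<in> carrier A. \<forall>x \<in> N. a \<odot>\<^bsub>M\<^esub> x \<in> N)"

lemma submodule_set_uminus:
  assumes "left_module A M" "submodule_set A M N" "x \<in> N"
  shows "\<ominus>\<^bsub>M\<^esub> x \<in> N"
proof -
  interpret M: left_module A M by fact
  have "\<ominus>\<^bsub>A\<^esub> \<one>\<^bsub>A\<^esub> \<in> carrier A"
    by simp
  then have "(\<ominus>\<^bsub>A\<^esub> \<one>\<^bsub>A\<^esub>) \<odot>\<^bsub>M\<^esub> x \<in> N"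
    using assms(2,3) unfolding submodule_set_def by blast
  then show ?thesis
    using smult_minus_one[OF assms(1), of x] assms(2,3) by (metis submodule_set_def subsetD)
qed

lemma left_module_sub:
  assumes "left_module A M" "submodule_set A M N"
  shows "left_module A (M\<lparr>carrier := N\<rparr>)"
proof -
  interpret M: left_module A M by fact
  have sub: "N \<subseteq> carrier M" and z: "\<zero>\<^bsub>M\<^esub> \<in> N"
    and add: "\<And>x y. \<lbrakk>x \<in> N; y \<in> N\<rbrakk> \<Longrightarrow> x \<oplus>\<^bsub>M\<^esub> y \<in> N"
    and sm: "\<And>a x. \<lbrakk>a \<in> carrier A; x \<in> N\<rbrakk> \<Longrightarrow> a \<odot>\<^bsub>M\<^esub> x \<in> N"
    using assms(2) by (auto simp: submodule_set_def)
  have c: "x \<in> carrier M" if "x \<in> N" for x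
    using sub that by blast
  have "abelian_group (M\<lparr>carrier := N\<rparr>)"
  proof (rule abelian_groupI)
    fix x assume "x \<in> carrier (M\<lparr>carrier := N\<rparr>)"
    then show "\<exists>y \<in> carrier (M\<lparr>carrier := N\<rparr>). y \<oplus>\<^bsub>M\<lparr>carrier := N\<rparr>\<^esub> x = \<zero>\<^bsub>M\<lparr>carrier := N\<rparr>\<^esub>"
      using c by (auto intro!: bexI[of _ "\<ominus>\<^bsub>M\<^esub> x"] submodule_set_uminus[OF assms] simp: M.M.l_neg)
  qed (simp_all add: add z c M.M.a_ac)
  moreover have "left_module_axioms A (M\<lparr>carrier := N\<rparr>)"
    by unfold_locales (simp_all add: sm c M.act_l_distr M.act_r_distr M.act_assoc M.act_one)
  ultimately show ?thesis
    by (simp add: left_module_def M.A.ring_axioms)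
qed

lemma inclusion_Hom:
  assumes "submodule_set A M N"
  shows "(\<lambda>x \<in> N. x) \<in> Hom A (M\<lparr>carrier := N\<rparr>) M"
  using assms by (intro HomI) (auto simp: submodule_set_def)

lemma Hom_image_corestrict: "f \<in> Hom A M N \<Longrightarrow> f \<in> Hom A M (N\<lparr>carrier := f ` carrier M\<rparr>)"
  by (simp add: Hom_def LinearCombinations.module_hom_def)

lemma submodule_set_image:
  assumes "left_module A M" "left_module A N" "f \<in> Hom A M N"
  shows "submodule_set A N (f ` carrier M)"
proof -
  interpret M: left_module A M by fact
  show ?thesis
    unfolding submodule_set_def
    using Hom_zero[OF assms] Hom_closed[OF assms(3)]
      Hom_add[OF assms(3), symmetric] Hom_smult[OF assms(3), symmetric]
    by (auto simp: M.act_closed intro!: image_eqI[of "\<zero>\<^bsub>N\<^esub>" f "\<zero>\<^bsub>M\<^esub>"])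
qed

lemma submodule_set_preimage:
  assumes "left_module A M" "left_module A N" "f \<in> Hom A M N" "submodule_set A N S"
  shows "submodule_set A M {x \<in> carrier M. f x \<in> S}"
proof -
  interpret M: left_module A M by fact
  show ?thesis
    using assms(4) unfolding submodule_set_def
    by (auto simp: M.act_closed Hom_zero[OF assms(1-3)] Hom_add[OF assms(3)] Hom_smult[OF assms(3)])
qed

lemma submodule_set_zero:
  assumes "left_module A M"
  shows "submodule_set A M {\<zero>\<^bsub>M\<^esub>}"
proof -
  interpret M: left_module A M by fact
  show ?thesis
    by (simp add: submodule_set_def zero_smult[OF assms])
qed

text \<open>
  The module axioms are equations, so they pass along a surjection that is compatible with the
  operations.  For a set of coset representatives it thus suffices that the operations respect
  congruence.
\<close>

lemma left_module_surj_image: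
  assumes "left_module A M" and surj: "q ` carrier M = carrier Q"
    and zero: "q \<zero>\<^bsub>M\<^esub> = \<zero>\<^bsub>Q\<^esub>"
    and add: "\<And>x y. \<lbrakk>x \<in> carrier M; y \<in> carrier M\<rbrakk> \<Longrightarrow> q (x \<oplus>\<^bsub>M\<^esub> y) = q x \<oplus>\<^bsub>Q\<^esub> q y"
    and smult: "\<And>a x. \<lbrakk>a \<in> carrier A; x \<in> carrier M\<rbrakk> \<Longrightarrow> q (a \<odot>\<^bsub>M\<^esub> x) = a \<odot>\<^bsub>Q\<^esub> q x"
  shows "left_module A Q"
proof -
  interpret M: left_module A M by fact
  have ex: "\<exists>x \<in> carrier M. y = q x" if "y \<in> carrier Q" for y
    using that surj by blast
  have c: "q x \<in> carrier Q" if "x \<in> carrier M" for x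
    using that surj by blast
  have "abelian_group Q"
  proof (rule abelian_groupI)
    fix x y assume "x \<in> carrier Q" "y \<in> carrier Q"
    then obtain x' y' where [simp]: "x' \<in> carrier M" "y' \<in> carrier M" "x = q x'" "y = q y'"
      using ex by blast
    show "x \<oplus>\<^bsub>Q\<^esub> y \<in> carrier Q"
      by (simp add: add[symmetric] c)
    show "x \<oplus>\<^bsub>Q\<^esub> y = y \<oplus>\<^bsub>Q\<^esub> x"
      by (simp add: add[symmetric] M.M.a_comm)
    fix z assume "z \<in> carrier Q"
    then obtain z' where [simp]: "z' \<in> carrier M" "z = q z'"
      using ex by blast
    show "x \<oplus>\<^bsub>Q\<^esub> y \<oplus>\<^bsub>Q\<^esub> z = x \<oplus>\<^bsub>Q\<^esub> (y \<oplus>\<^bsub>Q\<^esub> z)"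
      by (simp add: add[symmetric] M.M.a_assoc)
  next
    show "\<zero>\<^bsub>Q\<^esub> \<in> carrier Q"
      by (simp add: zero[symmetric] c)
  next
    fix x assume "x \<in> carrier Q"
    then obtain x' where [simp]: "x' \<in> carrier M" "x = q x'"
      using ex by blast
    show "\<zero>\<^bsub>Q\<^esub> \<oplus>\<^bsub>Q\<^esub> x = x"
      by (simp add: add[symmetric] zero[symmetric])
    show "\<exists>y \<in> carrier Q. y \<oplus>\<^bsub>Q\<^esub> x = \<zero>\<^bsub>Q\<^esub>"
      by (rule bexI[of _ "q (\<ominus>\<^bsub>M\<^esub> x')"]) (simp_all add: add[symmetric] zero[symmetric] c M.M.l_neg)
  qed
  moreover have "left_module_axioms A Q"
  proof
    fix a x assume [simp]: "a \<in> carrier A" "x \<in> carrier Q"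
    then obtain x' where [simp]: "x' \<in> carrier M" "x = q x'"
      using ex by blast
    show "a \<odot>\<^bsub>Q\<^esub> x \<in> carrier Q"
      by (simp add: smult[symmetric] c M.act_closed)
    {
      fix b assume [simp]: "b \<in> carrier A"
      show "(a \<oplus>\<^bsub>A\<^esub> b) \<odot>\<^bsub>Q\<^esub> x = a \<odot>\<^bsub>Q\<^esub> x \<oplus>\<^bsub>Q\<^esub> b \<odot>\<^bsub>Q\<^esub> x"
        by (simp add: smult[symmetric] add[symmetric] M.act_closed M.act_l_distr)
      show "(a \<otimes>\<^bsub>A\<^esub> b) \<odot>\<^bsub>Q\<^esub> x = a \<odot>\<^bsub>Q\<^esub> (b \<odot>\<^bsub>Q\<^esub> x)"
        by (simp add: smult[symmetric] M.act_closed M.act_assoc)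
    next
      fix y assume "y \<in> carrier Q"
      then obtain y' where [simp]: "y' \<in> carrier M" "y = q y'"
        using ex by blast
      show "a \<odot>\<^bsub>Q\<^esub> (x \<oplus>\<^bsub>Q\<^esub> y) = a \<odot>\<^bsub>Q\<^esub> x \<oplus>\<^bsub>Q\<^esub> a \<odot>\<^bsub>Q\<^esub> y"
        by (simp add: smult[symmetric] add[symmetric] M.act_closed M.act_r_distr)
    }
  next
    fix x assume "x \<in> carrier Q"
    then obtain x' where [simp]: "x' \<in> carrier M" "x = q x'"
      using ex by blast
    show "\<one>\<^bsub>A\<^esub> \<odot>\<^bsub>Q\<^esub> x = x"
      by (simp add: smult[symmetric] M.act_one)
  qed
  ultimately show ?thesis
    by (simp add: left_module_def M.A.ring_axioms)
qed

text \<open>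
  The objects of \<open>mod A\<close> live on one fixed type of elements, which a set of cosets does not have.
  Hence the quotient \<open>M/N\<close> is carried by one chosen representative for each coset.
\<close>

definition coset_rep :: "('a, 'v) module \<Rightarrow> 'v set \<Rightarrow> 'v \<Rightarrow> 'v" where
  "coset_rep M N x = (SOME y. y \<in> carrier M \<and> x \<ominus>\<^bsub>M\<^esub> y \<in> N)"

definition quotient_module :: "('a, 'v) module \<Rightarrow> 'v set \<Rightarrow> ('a, 'v) module" where
  "quotient_module M N =
     \<lparr>carrier = coset_rep M N ` carrier M, monoid.mult = monoid.mult M, one = one M,
      zero = coset_rep M N \<zero>\<^bsub>M\<^esub>, add = (\<lambda>x y. coset_rep M N (x \<oplus>\<^bsub>M\<^esub> y)),
      smult = (\<lambda>a x. coset_rep M N (a \<odot>\<^bsub>M\<^esub> x))\<rparr>"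

text \<open>
  Congruence modulo \<open>N\<close> is an equivalence relation, so congruent elements satisfy the same
  description of the representative and the choice returns the same element for them.
\<close>

lemma coset_rep_eq_iff:
  assumes "left_module A M" "submodule_set A M N"
    and x: "x \<in> carrier M" and y: "y \<in> carrier M"
  shows "coset_rep M N x = coset_rep M N y \<longleftrightarrow> x \<ominus>\<^bsub>M\<^esub> y \<in> N"
    and "coset_rep M N x \<in> carrier M" and "x \<ominus>\<^bsub>M\<^esub> coset_rep M N x \<in> N"
proof -
  interpret M: left_module A M by fact
  have z: "\<zero>\<^bsub>M\<^esub> \<in> N" and sub: "N \<subseteq> carrier M"
    and add: "\<And>u v. \<lbrakk>u \<in> N; v \<in> N\<rbrakk> \<Longrightarrow> u \<oplus>\<^bsub>M\<^esub> v \<in> N"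
    using assms(2) by (auto simp: submodule_set_def)
  have sym: "v \<ominus>\<^bsub>M\<^esub> u \<in> N" if "u \<in> carrier M" "v \<in> carrier M" "u \<ominus>\<^bsub>M\<^esub> v \<in> N" for u v
  proof -
    have "v \<ominus>\<^bsub>M\<^esub> u = \<ominus>\<^bsub>M\<^esub> (u \<ominus>\<^bsub>M\<^esub> v)"
      using that by (simp add: a_minus_def M.M.minus_add M.M.a_comm)
    then show ?thesis
      using submodule_set_uminus[OF assms(1,2)] that by simp
  qed
  have trans: "u \<ominus>\<^bsub>M\<^esub> w \<in> N"
    if "u \<in> carrier M" "v \<in> carrier M" "w \<in> carrier M" "u \<ominus>\<^bsub>M\<^esub> v \<in> N" "v \<ominus>\<^bsub>M\<^esub> w \<in> N" for u v w
  proof -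
    have "(u \<ominus>\<^bsub>M\<^esub> v) \<oplus>\<^bsub>M\<^esub> (v \<ominus>\<^bsub>M\<^esub> w) = u \<ominus>\<^bsub>M\<^esub> w"
      using that(1-3) by (simp add: a_minus_def M.M.a_assoc M.M.r_neg1)
    then show ?thesis
      using add[OF that(4,5)] by simp
  qed
  have rep: "coset_rep M N u \<in> carrier M \<and> u \<ominus>\<^bsub>M\<^esub> coset_rep M N u \<in> N" if "u \<in> carrier M" for u
    unfolding coset_rep_def
    by (rule someI[of _ u]) (use that z in \<open>simp add: a_minus_def M.M.r_neg\<close>)
  show "coset_rep M N x \<in> carrier M" "x \<ominus>\<^bsub>M\<^esub> coset_rep M N x \<in> N"
    using rep[OF x] by auto
  show "coset_rep M N x = coset_rep M N y \<longleftrightarrow> x \<ominus>\<^bsub>M\<^esub> y \<in> N"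
  proof
    assume "coset_rep M N x = coset_rep M N y"
    then show "x \<ominus>\<^bsub>M\<^esub> y \<in> N"
      using rep x y trans sym by metis
  next
    assume "x \<ominus>\<^bsub>M\<^esub> y \<in> N"
    then have "(u \<in> carrier M \<and> x \<ominus>\<^bsub>M\<^esub> u \<in> N) = (u \<in> carrier M \<and> y \<ominus>\<^bsub>M\<^esub> u \<in> N)" for u
      using x y trans sym by metis
    then show "coset_rep M N x = coset_rep M N y"
      by (simp add: coset_rep_def)
  qed
qed

lemma quotient_module:
  assumes "left_module A M" "submodule_set A M N"
  obtains q where "left_module A (quotient_module M N)" "q \<in> Hom A M (quotient_module M N)"
    "q ` carrier M = carrier (quotient_module M N)"
    "{x \<in> carrier M. q x = \<zero>\<^bsub>quotient_module M N\<^esub>} = N"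
proof -
  interpret M: left_module A M by fact
  have z: "\<zero>\<^bsub>M\<^esub> \<in> N" and sub: "N \<subseteq> carrier M"
    and addN: "\<And>u v. \<lbrakk>u \<in> N; v \<in> N\<rbrakk> \<Longrightarrow> u \<oplus>\<^bsub>M\<^esub> v \<in> N"
    and smN: "\<And>a u. \<lbrakk>a \<in> carrier A; u \<in> N\<rbrakk> \<Longrightarrow> a \<odot>\<^bsub>M\<^esub> u \<in> N"
    using assms(2) by (auto simp: submodule_set_def)
  let ?r = "coset_rep M N"
  note rep = coset_rep_eq_iff[OF assms]
  have add: "?r (x \<oplus>\<^bsub>M\<^esub> y) = ?r (?r x \<oplus>\<^bsub>M\<^esub> ?r y)" if xy: "x \<in> carrier M" "y \<in> carrier M" for x y
  proof -
    have c: "?r x \<in> carrier M" "?r y \<in> carrier M"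
      using rep xy by blast+
    have "(x \<oplus>\<^bsub>M\<^esub> y) \<ominus>\<^bsub>M\<^esub> (?r x \<oplus>\<^bsub>M\<^esub> ?r y) = (x \<ominus>\<^bsub>M\<^esub> ?r x) \<oplus>\<^bsub>M\<^esub> (y \<ominus>\<^bsub>M\<^esub> ?r y)"
      using xy c by (simp add: a_minus_def M.M.minus_add M.M.a_assoc M.M.a_lcomm)
    also have "\<dots> \<in> N"
      using addN rep(3) xy by blast
    finally show ?thesis
      using rep(1) xy c by simp
  qed
  have smult: "?r (a \<odot>\<^bsub>M\<^esub> x) = ?r (a \<odot>\<^bsub>M\<^esub> ?r x)" if ax: "a \<in> carrier A" "x \<in> carrier M" for a x
  proof -
    have c: "?r x \<in> carrier M"
      using rep ax by blast
    have "a \<odot>\<^bsub>M\<^esub> (x \<ominus>\<^bsub>M\<^esub> ?r x) \<oplus>\<^bsub>M\<^esub> a \<odot>\<^bsub>M\<^esub> ?r x = a \<odot>\<^bsub>M\<^esub> ((x \<ominus>\<^bsub>M\<^esub> ?r x) \<oplus>\<^bsub>M\<^esub> ?r x)"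
      using ax c by (simp add: M.act_r_distr)
    also have "(x \<ominus>\<^bsub>M\<^esub> ?r x) \<oplus>\<^bsub>M\<^esub> ?r x = x"
      using ax c by (simp add: a_minus_def M.M.a_assoc M.M.l_neg)
    finally have "a \<odot>\<^bsub>M\<^esub> x \<ominus>\<^bsub>M\<^esub> a \<odot>\<^bsub>M\<^esub> ?r x = a \<odot>\<^bsub>M\<^esub> (x \<ominus>\<^bsub>M\<^esub> ?r x)"
      using ax c by (metis M.M.add.inv_solve_right M.M.minus_closed M.act_closed a_minus_def)
    also have "\<dots> \<in> N"
      using smN rep(3) ax by blast
    finally show ?thesis
      using rep(1) ax c by (simp add: M.act_closed)
  qed
  define q where "q = restrict ?r (carrier M)"
  have "left_module A (quotient_module M N)"
    by (rule left_module_surj_image[OF assms(1), where q = ?r])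
      (use add smult in \<open>auto simp: quotient_module_def\<close>)
  moreover have "q \<in> Hom A M (quotient_module M N)"
    by (rule HomI) (use add smult in \<open>auto simp: q_def quotient_module_def M.act_closed\<close>)
  moreover have "q ` carrier M = carrier (quotient_module M N)"
    by (auto simp: q_def quotient_module_def)
  moreover have "{x \<in> carrier M. q x = \<zero>\<^bsub>quotient_module M N\<^esub>} = N"
  proof -
    have "x \<ominus>\<^bsub>M\<^esub> \<zero>\<^bsub>M\<^esub> = x" if "x \<in> carrier M" for x
      using that by (simp add: a_minus_def)
    then show ?thesis
      using sub rep(1)[OF _ M.M.zero_closed] by (auto simp: q_def quotient_module_def)
  qed
  ultimately show thesis
    using that by blast
qed

text \<open>
  The universal property of a surjection: what vanishes on its kernel factors through it, by way of
  an arbitrary section.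
\<close>

lemma Hom_factor:
  assumes "left_module A Y" "left_module A Z" "left_module A B"
    and g: "g \<in> Hom A Y Z" and surj: "g ` carrier Y = carrier Z"
    and h: "h \<in> Hom A Y B" and ker: "\<And>y. \<lbrakk>y \<in> carrier Y; g y = \<zero>\<^bsub>Z\<^esub>\<rbrakk> \<Longrightarrow> h y = \<zero>\<^bsub>B\<^esub>"
  obtains h' where "h' \<in> Hom A Z B" "\<And>y. y \<in> carrier Y \<Longrightarrow> h' (g y) = h y"
proof -
  interpret Y: left_module A Y by fact
  interpret Z: left_module A Z by fact
  interpret B: left_module A B by fact
  define s where "s = inv_into (carrier Y) g"
  have s: "s z \<in> carrier Y" "g (s z) = z" if "z \<in> carrier Z" for z
    using that surj by (auto simp: s_def inv_into_into f_inv_into_f)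
  define h' where "h' = (\<lambda>z \<in> carrier Z. h (s z))"
  have gc: "g y \<in> carrier Z" if "y \<in> carrier Y" for y
    using that Hom_closed[OF g] by blast
  have eq: "h' (g y) = h y" if y: "y \<in> carrier Y" for y
  proof -
    note sy = s[OF gc[OF y]]
    have "g (s (g y) \<ominus>\<^bsub>Y\<^esub> y) = \<zero>\<^bsub>Z\<^esub>"
      using sy y gc by (simp add: Hom_minus[OF assms(1,2) g]
          minus_eq_zero_iff[OF Z.M.abelian_group_axioms])
    then have "h (s (g y) \<ominus>\<^bsub>Y\<^esub> y) = \<zero>\<^bsub>B\<^esub>"
      using ker sy y by simp
    then have "h (s (g y)) = h y"
      using sy y Hom_closed[OF h] by (simp add: Hom_minus[OF assms(1,3) h]
          minus_eq_zero_iff[OF B.M.abelian_group_axioms])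
    then show ?thesis
      using gc y by (simp add: h'_def)
  qed
  have "h' \<in> Hom A Z B"
  proof (rule HomI)
    fix x assume "x \<in> carrier Z" then show "h' x \<in> carrier B"
      using s Hom_closed[OF h] by (simp add: h'_def)
  next
    fix x y assume "x \<in> carrier Z" "y \<in> carrier Z"
    then obtain x' y' where [simp]: "x' \<in> carrier Y" "x = g x'" "y' \<in> carrier Y" "y = g y'"
      using surj by blast
    show "h' (x \<oplus>\<^bsub>Z\<^esub> y) = h' x \<oplus>\<^bsub>B\<^esub> h' y"
      by (simp add: Hom_add[OF g, symmetric] eq Hom_add[OF h])
  next
    fix a x assume [simp]: "a \<in> carrier A" and "x \<in> carrier Z"
    then obtain x' where [simp]: "x' \<in> carrier Y" "x = g x'"
      using surj by blast
    show "h' (a \<odot>\<^bsub>Z\<^esub> x) = a \<odot>\<^bsub>B\<^esub> h' x"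
      by (simp add: Hom_smult[OF g, symmetric] eq Hom_smult[OF h] Y.act_closed)
  qed (simp add: h'_def)
  with eq that show thesis by blast
qed

section \<open>Finite dimensional modules\<close>

text \<open>
  Independence of a subset of \<open>W\<close> means the same in \<open>W\<close> as in \<open>V\<close>, so independent subsets of \<open>W\<close> have
  at most \<open>dim V\<close> elements and a maximal one is a basis of \<open>W\<close>.  If it has \<open>dim V\<close> elements, it is a
  basis of \<open>V\<close> too.
\<close>

lemma (in vectorspace) subspace_fin_dim:
  assumes fin: "fin_dim" and W: "VectorSpace.subspace K W V"
  shows "vectorspace.fin_dim K (vs W)" and "vectorspace.dim K (vs W) \<le> dim"
    and "vectorspace.dim K (vs W) = dim \<Longrightarrow> W = carrier V"
proof -
  interpret W: vectorspace K "vs W"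
    by (rule subspace_is_vs[OF W])
  have sub: "LinearCombinations.submodule K W V"
    by (rule is_module[OF W])
  have WV: "W \<subseteq> carrier V"
    using sub by (simp add: LinearCombinations.submodule_def)
  have li: "W.lin_dep S \<longleftrightarrow> lin_dep S" and sp: "W.span S = span S" if "S \<subseteq> W" for S
    using span_li_not_depend[OF that sub] by auto
  have bound: "finite S \<and> card S \<le> dim" if "S \<subseteq> carrier (vs W) \<and> W.lin_indpt S" for S
    using that li WV li_le_dim[OF fin, of S] by auto
  have "W.lin_indpt {}"
    by (auto simp: W.lin_dep_def)
  then obtain S where S: "finite S" "maximal S (\<lambda>S. S \<subseteq> carrier (vs W) \<and> W.lin_indpt S)"
    using maximal_exists[of "\<lambda>S. S \<subseteq> carrier (vs W) \<and> W.lin_indpt S" dim "{}"] bound by auto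
  then have basis: "W.basis S" and SW: "S \<subseteq> W" and liS: "lin_indpt S"
    using W.max_li_is_basis li by (auto simp: maximal_def)
  show "W.fin_dim"
    using S(1) basis by (auto simp: W.fin_dim_def W.basis_def)
  have dimS: "W.dim = card S"
    using W.dim_basis[OF S(1) basis] .
  show "W.dim \<le> dim"
    using bound[of S] dimS SW liS li by auto
  show "W = carrier V" if "W.dim = dim"
  proof -
    have "basis S"
      using dim_li_is_basis[OF fin S(1)] SW WV liS dimS that by auto
    then have "span S = carrier V"
      by (simp add: basis_def)
    moreover have "W.span S = W"
      using basis by (simp add: W.basis_def)
    ultimately show ?thesis
      using sp[OF SW] by simp
  qed
qed

lemma carrier_underlying_space [simp]: "carrier (underlying_space A M) = carrier M"
  and zero_underlying_space [simp]: "\<zero>\<^bsub>underlying_space A M\<^esub> = \<zero>\<^bsub>M\<^esub>"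
  and add_underlying_space [simp]: "x \<oplus>\<^bsub>underlying_space A M\<^esub> y = x \<oplus>\<^bsub>M\<^esub> y"
  and smult_underlying_space [simp]:
    "c \<odot>\<^bsub>underlying_space A M\<^esub> x = (c \<odot>\<^bsub>A\<^esub> \<one>\<^bsub>A\<^esub>) \<odot>\<^bsub>M\<^esub> x"
  by (simp_all add: underlying_space_def)

lemma underlying_space_sub:
  "underlying_space A (M\<lparr>carrier := N\<rparr>) = (underlying_space A M)\<lparr>carrier := N\<rparr>"
  by (simp add: underlying_space_def)

context fd_algebra
begin

lemma underlying_vectorspace:
  assumes "left_module A M"
  shows "vectorspace K (underlying_space A M)"
proof -
  interpret M: left_module A M by fact
  have "abelian_group (underlying_space A M)"
    by (rule abelian_groupI) (auto simp: M.M.a_ac intro!: bexI[of _ "\<ominus>\<^bsub>M\<^esub> _"] M.M.l_neg)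
  moreover have "(c \<otimes>\<^bsub>K\<^esub> d) \<odot>\<^bsub>A\<^esub> \<one>\<^bsub>A\<^esub> = (c \<odot>\<^bsub>A\<^esub> \<one>\<^bsub>A\<^esub>) \<otimes>\<^bsub>A\<^esub> (d \<odot>\<^bsub>A\<^esub> \<one>\<^bsub>A\<^esub>)"
    if "c \<in> carrier K" "d \<in> carrier K" for c d
    using that by (simp add: smult_mult_left smult_assoc1)
  ultimately have "Module.module K (underlying_space A M)"
    by (intro moduleI)
      (simp_all add: R.is_cring M.act_closed M.act_l_distr M.act_r_distr M.act_assoc M.act_one
        smult_l_distr)
  then show ?thesis
    by (simp add: vectorspace_def field_axioms)
qed

lemma Hom_linear_map:
  assumes "left_module A M" "left_module A N" "f \<in> Hom A M N"
  shows "VectorSpace.linear_map K (underlying_space A M) (underlying_space A N) f"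
proof -
  interpret M: vectorspace K "underlying_space A M"
    by (rule underlying_vectorspace) fact
  interpret N: vectorspace K "underlying_space A N"
    by (rule underlying_vectorspace) fact
  have "f \<in> LinearCombinations.module_hom K (underlying_space A M) (underlying_space A N)"
    using Hom_closed[OF assms(3)] Hom_add[OF assms(3)] Hom_smult[OF assms(3)]
    by (auto simp: LinearCombinations.module_hom_def)
  then show ?thesis
    by (simp add: VectorSpace.linear_map_def mod_hom_def mod_hom_axioms_def M.vectorspace_axioms
        N.vectorspace_axioms M.module_axioms N.module_axioms)
qed

lemma submodule_subspace:
  assumes "left_module A M" "submodule_set A M N"
  shows "VectorSpace.subspace K N (underlying_space A M)"
proof -
  interpret M: vectorspace K "underlying_space A M"
    by (rule underlying_vectorspace) fact
  show ?thesis
    using assms(2)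
    by (auto simp: VectorSpace.subspace_def LinearCombinations.submodule_def submodule_set_def
        M.vectorspace_axioms M.module_axioms)
qed

definition mdim :: "('a, nat \<Rightarrow> 'k) module \<Rightarrow> nat" where
  "mdim M = vectorspace.dim K (underlying_space A M)"

lemma mod_catD: "M \<in> mod_cat K A \<Longrightarrow> left_module A M"
  by (simp add: mod_cat_def)

lemma
  assumes M: "M \<in> mod_cat K A" and N: "submodule_set A M N"
  shows sub_mod_cat: "M\<lparr>carrier := N\<rparr> \<in> mod_cat K A"
    and mdim_sub_le: "mdim (M\<lparr>carrier := N\<rparr>) \<le> mdim M"
    and mdim_sub_less: "N \<noteq> carrier M \<Longrightarrow> mdim (M\<lparr>carrier := N\<rparr>) < mdim M"
proof -
  have lm: "left_module A M"
    by (rule mod_catD[OF M])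
  interpret M: vectorspace K "underlying_space A M"
    by (rule underlying_vectorspace[OF lm])
  have fin: "M.fin_dim"
    using M by (simp add: mod_cat_def)
  note sub = M.subspace_fin_dim[OF fin submodule_subspace[OF lm N]]
  show "M\<lparr>carrier := N\<rparr> \<in> mod_cat K A"
    using sub(1) left_module_sub[OF lm N] by (simp add: mod_cat_def underlying_space_sub)
  show le: "mdim (M\<lparr>carrier := N\<rparr>) \<le> mdim M"
    using sub(2) by (simp add: mdim_def underlying_space_sub)
  show "mdim (M\<lparr>carrier := N\<rparr>) < mdim M" if "N \<noteq> carrier M"
    using sub(3) le that by (auto simp: mdim_def underlying_space_sub order_less_le)
qed

text \<open>
  Rank-nullity.  A nonzero kernel has positive dimension because the zero module is a proper
  submodule of it.
\<close>

lemma
  assumes M: "M \<in> mod_cat K A" and N: "left_module A N"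
    and f: "f \<in> Hom A M N" and surj: "f ` carrier M = carrier N"
  shows surj_mod_cat: "N \<in> mod_cat K A"
    and mdim_surj_le: "mdim N \<le> mdim M"
    and mdim_surj_less: "\<not> inj_on f (carrier M) \<Longrightarrow> mdim N < mdim M"
    and mdim_bij: "inj_on f (carrier M) \<Longrightarrow> mdim N = mdim M"
proof -
  have lm: "left_module A M"
    by (rule mod_catD[OF M])
  interpret f: linear_map K "underlying_space A M" "underlying_space A N" f
    by (rule Hom_linear_map[OF lm N f])
  have fin: "f.V.fin_dim"
    using M by (simp add: mod_cat_def)
  have s: "f ` carrier (underlying_space A M) = carrier (underlying_space A N)"
    using surj by simp
  show "N \<in> mod_cat K A"
    using f.surj_fin_dim[OF fin s] N by (simp add: mod_cat_def)
  define L where "L = {x \<in> carrier M. f x = \<zero>\<^bsub>N\<^esub>}"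
  have L: "submodule_set A M L"
    using submodule_set_preimage[OF lm N f submodule_set_zero[OF N]] by (simp add: L_def)
  have "f.kerT = L"
    by (simp add: f.ker_def L_def)
  then have rn: "mdim N + mdim (M\<lparr>carrier := L\<rparr>) = mdim M"
    using f.rank_nullity[OF fin] f.surj_imp_imT_carrier[OF s]
    by (simp add: mdim_def underlying_space_sub underlying_space_def)
  then show "mdim N \<le> mdim M"
    by simp
  show "mdim N = mdim M" if "inj_on f (carrier M)"
    using f.dim_eq[OF fin _ s] that by (simp add: mdim_def)
  show "mdim N < mdim M" if "\<not> inj_on f (carrier M)"
  proof -
    have "L \<noteq> {\<zero>\<^bsub>M\<^esub>}"
      using that Hom_inj_on_iff[OF lm N f] by (auto simp: L_def)
    moreover have "submodule_set A (M\<lparr>carrier := L\<rparr>) {\<zero>\<^bsub>M\<^esub>}"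
      using submodule_set_zero[OF left_module_sub[OF lm L]] by simp
    ultimately have "0 < mdim (M\<lparr>carrier := L\<rparr>)"
      using mdim_sub_less[OF sub_mod_cat[OF M L], of "{\<zero>\<^bsub>M\<^esub>}"] by simp
    then show ?thesis
      using rn by simp
  qed
qed

lemma quotient_mod_cat:
  assumes M: "M \<in> mod_cat K A" and N: "submodule_set A M N"
  obtains Q q where "Q \<in> mod_cat K A" "q \<in> Hom A M Q" "q ` carrier M = carrier Q"
    "{x \<in> carrier M. q x = \<zero>\<^bsub>Q\<^esub>} = N"
proof -
  obtain q where q: "left_module A (quotient_module M N)" "q \<in> Hom A M (quotient_module M N)"
    "q ` carrier M = carrier (quotient_module M N)"
    "{x \<in> carrier M. q x = \<zero>\<^bsub>quotient_module M N\<^esub>} = N"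
    by (rule quotient_module[OF mod_catD[OF M] N])
  show thesis
    by (rule that[OF surj_mod_cat[OF M q(1-3)] q(2-4)])
qed

text \<open>
  The image is a submodule of \<open>N\<close>, so \<open>f\<close> itself is the surjection onto it, and the inclusion
  fixes every element.
\<close>

lemma image_factorization:
  assumes M: "M \<in> mod_cat K A" and N: "N \<in> mod_cat K A" and f: "f \<in> Hom A M N"
  obtains I i where "I \<in> mod_cat K A" "f \<in> Hom A M I" "f ` carrier M = carrier I"
    "i \<in> Hom A I N" "inj_on i (carrier I)" "\<And>y. y \<in> carrier I \<Longrightarrow> i y = y" "\<zero>\<^bsub>I\<^esub> = \<zero>\<^bsub>N\<^esub>"
proof -
  have s: "submodule_set A N (f ` carrier M)"
    by (rule submodule_set_image[OF mod_catD[OF M] mod_catD[OF N] f])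
  show thesis
    by (rule that[of "N\<lparr>carrier := f ` carrier M\<rparr>" "\<lambda>x \<in> f ` carrier M. x"])
      (use sub_mod_cat[OF N s] Hom_image_corestrict[OF f] inclusion_Hom[OF s] in
        \<open>auto simp: inj_on_def\<close>)
qed

lemma mdim_inj:
  assumes M: "M \<in> mod_cat K A" and N: "N \<in> mod_cat K A"
    and f: "f \<in> Hom A M N" and inj: "inj_on f (carrier M)"
  shows "mdim M \<le> mdim N" and "f ` carrier M \<noteq> carrier N \<Longrightarrow> mdim M < mdim N"
proof -
  have s: "submodule_set A N (f ` carrier M)"
    by (rule submodule_set_image[OF mod_catD[OF M] mod_catD[OF N] f])
  have "mdim (N\<lparr>carrier := f ` carrier M\<rparr>) = mdim M"
    by (rule mdim_bij[OF M mod_catD[OF sub_mod_cat[OF N s]] Hom_image_corestrict[OF f] _ inj]) simp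
  then show "mdim M \<le> mdim N" "f ` carrier M \<noteq> carrier N \<Longrightarrow> mdim M < mdim N"
    using mdim_sub_le[OF N s] mdim_sub_less[OF N s] by simp_all
qed

end

section \<open>Bricks\<close>

lemma Hom_plus:
  assumes "left_module A M" "left_module A N" "f \<in> Hom A M N" "g \<in> Hom A M N"
  shows "(\<lambda>x \<in> carrier M. f x \<oplus>\<^bsub>N\<^esub> g x) \<in> Hom A M N"
proof -
  interpret M: left_module A M by fact
  interpret N: left_module A N by fact
  show ?thesis
    by (rule HomI)
      (simp_all add: Hom_closed[OF assms(3)] Hom_closed[OF assms(4)] Hom_add[OF assms(3)]
        Hom_add[OF assms(4)] Hom_smult[OF assms(3)] Hom_smult[OF assms(4)] M.act_closed
        N.act_r_distr N.M.a_ac)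
qed

lemma Hom_uminus:
  assumes "left_module A M" "left_module A N" "f \<in> Hom A M N"
  shows "(\<lambda>x \<in> carrier M. \<ominus>\<^bsub>N\<^esub> f x) \<in> Hom A M N"
proof -
  interpret M: left_module A M by fact
  interpret N: left_module A N by fact
  have "\<ominus>\<^bsub>N\<^esub> (a \<odot>\<^bsub>N\<^esub> y) = a \<odot>\<^bsub>N\<^esub> (\<ominus>\<^bsub>N\<^esub> y)" if "a \<in> carrier A" "y \<in> carrier N" for a y
  proof (rule N.M.minus_equality)
    show "a \<odot>\<^bsub>N\<^esub> (\<ominus>\<^bsub>N\<^esub> y) \<oplus>\<^bsub>N\<^esub> a \<odot>\<^bsub>N\<^esub> y = \<zero>\<^bsub>N\<^esub>"
      using that by (simp add: N.act_r_distr[symmetric] N.M.l_neg zero_smult[OF assms(2)])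
  qed (use that in \<open>simp_all add: N.act_closed\<close>)
  then show ?thesis
    by (intro HomI)
      (simp_all add: Hom_closed[OF assms(3)] Hom_add[OF assms(3)] Hom_smult[OF assms(3)]
        M.act_closed N.M.minus_add N.M.a_comm)
qed

lemma endomorphism_ring:
  assumes "left_module A M"
  shows "ring (endomorphism_ring A M)"
proof -
  interpret M: left_module A M by fact
  let ?E = "endomorphism_ring A M"
  note lm = assms
  have "abelian_group ?E"
  proof (rule abelian_groupI)
    fix f assume f: "f \<in> carrier ?E"
    show "\<zero>\<^bsub>?E\<^esub> \<oplus>\<^bsub>?E\<^esub> f = f"
      using f Hom_closed[of f A M M] Hom_extensional[of f A M M]
      by (auto simp: endomorphism_ring_def zero_hom_def fun_eq_iff extensional_def)
    show "\<exists>g \<in> carrier ?E. g \<oplus>\<^bsub>?E\<^esub> f = \<zero>\<^bsub>?E\<^esub>"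
      using f Hom_uminus[OF lm lm, of f] Hom_closed[of f A M M]
      by (intro bexI[of _ "\<lambda>x \<in> carrier M. \<ominus>\<^bsub>M\<^esub> f x"])
        (auto simp: endomorphism_ring_def zero_hom_def fun_eq_iff M.M.l_neg)
  qed (auto simp: endomorphism_ring_def zero_hom_Hom[OF lm lm] Hom_plus[OF lm lm] fun_eq_iff
      Hom_closed[of _ A M M] M.M.a_ac)
  moreover have "monoid ?E"
  proof (rule monoidI)
    fix f assume "f \<in> carrier ?E"
    then show "\<one>\<^bsub>?E\<^esub> \<otimes>\<^bsub>?E\<^esub> f = f" "f \<otimes>\<^bsub>?E\<^esub> \<one>\<^bsub>?E\<^esub> = f"
      using Hom_closed[of f A M M] Hom_extensional[of f A M M]
      by (auto simp: endomorphism_ring_def compose_def fun_eq_iff extensional_def)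
  next
    fix f g assume "f \<in> carrier ?E" "g \<in> carrier ?E"
    then show "f \<otimes>\<^bsub>?E\<^esub> g \<in> carrier ?E"
      using Hom_compose[OF lm, of g M f M] by (simp add: endomorphism_ring_def)
  qed (auto simp: endomorphism_ring_def id_Hom[OF lm] compose_def fun_eq_iff
      Hom_closed[of _ A M M])
  ultimately show ?thesis
    by (rule ringI)
      (auto simp: endomorphism_ring_def compose_def fun_eq_iff
        Hom_closed[of _ A M M] Hom_add[of _ A M M])
qed

text \<open>
  The units of the endomorphism ring are the bijective endomorphisms, as the inverse of a bijective
  homomorphism is a homomorphism.
\<close>

lemma is_brick_iff:
  assumes "left_module A M"
  shows "is_brick A M \<longleftrightarrow> carrier M \<noteq> {\<zero>\<^bsub>M\<^esub>} \<and>
    (\<forall>f \<in> Hom A M M. (\<forall>x \<in> carrier M. f x = \<zero>\<^bsub>M\<^esub>) \<or> bij_betw f (carrier M) (carrier M))"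
proof -
  interpret M: left_module A M by fact
  let ?E = "endomorphism_ring A M"
  note lm = assms
  interpret E: ring ?E
    by (rule endomorphism_ring[OF lm])
  have zero: "f = \<zero>\<^bsub>?E\<^esub> \<longleftrightarrow> (\<forall>x \<in> carrier M. f x = \<zero>\<^bsub>M\<^esub>)" if "f \<in> Hom A M M" for f
    using Hom_eqI[OF that zero_hom_Hom[OF lm lm]]
    by (auto simp: endomorphism_ring_def zero_hom_def)
  have unit: "f \<in> Units ?E \<longleftrightarrow> bij_betw f (carrier M) (carrier M)" if f: "f \<in> Hom A M M" for f
  proof
    assume "f \<in> Units ?E"
    then obtain g where g: "g \<in> Hom A M M" "g \<otimes>\<^bsub>?E\<^esub> f = \<one>\<^bsub>?E\<^esub>" "f \<otimes>\<^bsub>?E\<^esub> g = \<one>\<^bsub>?E\<^esub>"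
      by (auto simp: Units_def endomorphism_ring_def)
    then have "g (f x) = x" "f (g x) = x" if "x \<in> carrier M" for x
      using that by (auto simp: endomorphism_ring_def compose_def fun_eq_iff dest!: spec[of _ x])
    then show "bij_betw f (carrier M) (carrier M)"
      using Hom_closed[OF f] Hom_closed[OF g(1)] by (intro bij_betw_byWitness[of _ g]) auto
  next
    assume "bij_betw f (carrier M) (carrier M)"
    then obtain g where "g \<in> Hom A M M" "bij_betw g (carrier M) (carrier M)"
      "\<And>x. x \<in> carrier M \<Longrightarrow> g (f x) = x" "\<And>y. y \<in> carrier M \<Longrightarrow> f (g y) = y"
      by (rule Hom_inverse[OF lm lm f]) blast
    then show "f \<in> Units ?E"
      using f by (auto simp: Units_def endomorphism_ring_def compose_def intro!: bexI[of _ g])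
  qed
  show ?thesis
  proof
    assume "is_brick A M"
    then have U: "Units ?E = carrier ?E - {\<zero>\<^bsub>?E\<^esub>}"
      by (simp add: is_brick_def division_ring_def)
    have "\<one>\<^bsub>?E\<^esub> \<noteq> \<zero>\<^bsub>?E\<^esub>"
      using U E.Units_one_closed by blast
    then have "carrier M \<noteq> {\<zero>\<^bsub>M\<^esub>}"
      using zero[OF id_Hom[OF lm]] by (auto simp: endomorphism_ring_def)
    moreover have "(\<forall>x \<in> carrier M. f x = \<zero>\<^bsub>M\<^esub>) \<or> bij_betw f (carrier M) (carrier M)"
      if f: "f \<in> Hom A M M" for f
    proof -
      have "f \<in> carrier ?E"
        using f by (simp add: endomorphism_ring_def)
      then show ?thesis
        using U zero[OF f] unit[OF f] by blast
    qed
    ultimately show "carrier M \<noteq> {\<zero>\<^bsub>M\<^esub>} \<and> (\<forall>f \<in> Hom A M M.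
        (\<forall>x \<in> carrier M. f x = \<zero>\<^bsub>M\<^esub>) \<or> bij_betw f (carrier M) (carrier M))"
      by blast
  next
    assume *: "carrier M \<noteq> {\<zero>\<^bsub>M\<^esub>} \<and> (\<forall>f \<in> Hom A M M.
        (\<forall>x \<in> carrier M. f x = \<zero>\<^bsub>M\<^esub>) \<or> bij_betw f (carrier M) (carrier M))"
    have cE: "carrier ?E = Hom A M M"
      by (simp add: endomorphism_ring_def)
    have "\<not> bij_betw f (carrier M) (carrier M)" if "f = \<zero>\<^bsub>?E\<^esub>" for f
    proof
      assume bij: "bij_betw f (carrier M) (carrier M)"
      have "f ` carrier M \<subseteq> {\<zero>\<^bsub>M\<^esub>}"
        using that by (auto simp: endomorphism_ring_def zero_hom_def)
      then show False
        using bij * M.M.zero_closed by (auto simp: bij_betw_def)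
    qed
    then have "f \<in> Units ?E \<longleftrightarrow> f \<noteq> \<zero>\<^bsub>?E\<^esub>" if "f \<in> Hom A M M" for f
      using unit[OF that] zero[OF that] * that by blast
    moreover have "Units ?E \<subseteq> carrier ?E"
      by (auto simp: Units_def)
    ultimately have "Units ?E = carrier ?E - {\<zero>\<^bsub>?E\<^esub>}"
      using cE by blast
    then show "is_brick A M"
      using E.ring_axioms by (simp add: is_brick_def division_ring_def)
  qed
qed

context fd_algebra
begin

lemma brick_endomorphism:
  assumes "is_brick A B" "B \<in> mod_cat K A" "f \<in> Hom A B B" "x \<in> carrier B" "f x \<noteq> \<zero>\<^bsub>B\<^esub>"
  shows "inj_on f (carrier B)" and "f ` carrier B = carrier B"
  using assms is_brick_iff[OF mod_catD[OF assms(2)]] by (auto simp: bij_betw_def)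

lemma brick_not_orthogonal_self:
  assumes "is_brick A B" "B \<in> mod_cat K A"
  shows "\<not> orthogonal A B B"
proof -
  interpret B: left_module A B
    by (rule mod_catD[OF assms(2)])
  obtain x where "x \<in> carrier B" "x \<noteq> \<zero>\<^bsub>B\<^esub>"
    using assms is_brick_iff[OF mod_catD[OF assms(2)]] B.M.zero_closed by blast
  then show ?thesis
    using id_Hom[OF mod_catD[OF assms(2)]] by (force simp: orthogonal_def)
qed

text \<open>
  The source of all bricks in this development.  Let \<open>B\<close> be nonzero of least dimension in \<open>\<C>\<close> and
  \<open>f\<close> a nonzero endomorphism of \<open>B\<close>.  Its image is in \<open>\<C>\<close> and nonzero, so it has the dimension of \<open>B\<close>;
  hence \<open>f\<close> is bijective.
\<close>

lemma brick_of_minimal_dimension: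
  assumes C: "\<C> \<subseteq> mod_cat K A" and M: "M \<in> \<C>" "carrier M \<noteq> {\<zero>\<^bsub>M\<^esub>}"
    and closed: "\<And>X I p i. \<lbrakk>X \<in> \<C>; I \<in> mod_cat K A; p \<in> Hom A X I; p ` carrier X = carrier I;
       i \<in> Hom A I X; inj_on i (carrier I)\<rbrakk> \<Longrightarrow> I \<in> \<C>"
  obtains B where "B \<in> \<C>" "is_brick A B"
    "\<And>X. \<lbrakk>X \<in> \<C>; carrier X \<noteq> {\<zero>\<^bsub>X\<^esub>}\<rbrakk> \<Longrightarrow> mdim B \<le> mdim X"
proof -
  define P where "P X \<longleftrightarrow> X \<in> \<C> \<and> carrier X \<noteq> {\<zero>\<^bsub>X\<^esub>}" for X
  obtain B where B: "P B" and min: "\<And>X. P X \<Longrightarrow> mdim B \<le> mdim X"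
    using M ex_has_least_nat[of P M mdim] by (auto simp: P_def)
  have BC: "B \<in> \<C>" and Bm: "B \<in> mod_cat K A"
    using B C by (auto simp: P_def)
  note lm = mod_catD[OF Bm]
  have "(\<forall>x \<in> carrier B. f x = \<zero>\<^bsub>B\<^esub>) \<or> bij_betw f (carrier B) (carrier B)"
    if f: "f \<in> Hom A B B" for f
  proof (cases "\<forall>x \<in> carrier B. f x = \<zero>\<^bsub>B\<^esub>")
    case False
    obtain I i where I: "I \<in> mod_cat K A" "f \<in> Hom A B I" "f ` carrier B = carrier I"
      "i \<in> Hom A I B" "inj_on i (carrier I)" "\<zero>\<^bsub>I\<^esub> = \<zero>\<^bsub>B\<^esub>"
      by (rule image_factorization[OF Bm Bm f]) blast
    have "P I"
      using closed[OF BC I(1-5)] False I(3,6) by (auto simp: P_def)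
    then have "mdim B \<le> mdim I"
      by (rule min)
    then have inj: "inj_on f (carrier B)"
      using mdim_surj_less[OF Bm mod_catD[OF I(1)] I(2,3)] by fastforce
    then show ?thesis
      using mdim_inj(2)[OF Bm Bm f inj] by (auto simp: bij_betw_def)
  qed simp
  then have "is_brick A B"
    using B is_brick_iff[OF lm] by (simp add: P_def)
  moreover have "mdim B \<le> mdim X" if "X \<in> \<C>" "carrier X \<noteq> {\<zero>\<^bsub>X\<^esub>}" for X
    using min[of X] that by (simp add: P_def)
  ultimately show thesis
    using that BC by blast
qed

text \<open>
  A nonzero homomorphism \<open>h\<close> from the quotient to \<open>B\<close> would give a nonzero endomorphism \<open>h \<circ> q\<close> that
  is not injective.
\<close>

lemma brick_quotient_orthogonal:
  assumes B: "is_brick A B" "B \<in> mod_cat K A" and Q: "Q \<in> mod_cat K A"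
    and q: "q \<in> Hom A B Q" "q ` carrier B = carrier Q" "\<not> inj_on q (carrier B)"
  shows "orthogonal A Q B"
proof (rule ccontr)
  assume "\<not> orthogonal A Q B"
  then obtain h y where h: "h \<in> Hom A Q B" "y \<in> carrier Q" "h y \<noteq> \<zero>\<^bsub>B\<^esub>"
    by (auto simp: orthogonal_def)
  then obtain x where x: "x \<in> carrier B" "y = q x"
    using q(2) by blast
  have "inj_on (compose (carrier B) h q) (carrier B)"
    by (rule brick_endomorphism(1)[OF B Hom_compose[OF mod_catD[OF B(2)] q(1) h(1)] x(1)])
      (use h x in \<open>simp add: compose_def\<close>)
  then have "inj_on q (carrier B)"
    by (auto simp: inj_on_def compose_def)
  with q(3) show False by simp
qed

section \<open>Torsion classes\<close>

lemma
  assumes "torsion_class K A \<T>"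
  shows torsion_class_subset: "\<T> \<subseteq> mod_cat K A"
    and torsion_class_nonempty: "\<T> \<noteq> {}"
    and torsion_class_iso: "\<lbrakk>M \<in> \<T>; N \<in> mod_cat K A; module_iso A M N\<rbrakk> \<Longrightarrow> N \<in> \<T>"
    and torsion_class_quotient:
      "\<lbrakk>M \<in> \<T>; N \<in> mod_cat K A; g \<in> Hom A M N; g ` carrier M = carrier N\<rbrakk> \<Longrightarrow> N \<in> \<T>"
    and torsion_class_extension:
      "\<lbrakk>X \<in> \<T>; Z \<in> \<T>; Y \<in> mod_cat K A; short_exact A X f Y g Z\<rbrakk> \<Longrightarrow> Y \<in> \<T>"
  using assms unfolding torsion_class_def by blast+

lemma torsion_classI:
  assumes "\<T> \<subseteq> mod_cat K A" "\<T> \<noteq> {}"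
    and "\<And>M N g. \<lbrakk>M \<in> \<T>; N \<in> mod_cat K A; g \<in> Hom A M N; g ` carrier M = carrier N\<rbrakk> \<Longrightarrow> N \<in> \<T>"
    and "\<And>X Y Z f g. \<lbrakk>X \<in> \<T>; Z \<in> \<T>; Y \<in> mod_cat K A; short_exact A X f Y g Z\<rbrakk> \<Longrightarrow> Y \<in> \<T>"
  shows "torsion_class K A \<T>"
proof -
  have "N \<in> \<T>" if "M \<in> \<T>" "N \<in> mod_cat K A" "module_iso A M N" for M N
    using that assms(3)[OF that(1,2)] by (auto simp: module_iso_def bij_betw_def)
  then show ?thesis
    unfolding torsion_class_def
  proof (intro conjI ballI impI assms(1,2))
    fix M N assume "M \<in> \<T>" "N \<in> mod_cat K A" "\<exists>g \<in> Hom A M N. g ` carrier M = carrier N"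
    then show "N \<in> \<T>"
      by (elim bexE) (rule assms(3))
  next
    fix X Y Z assume "X \<in> \<T>" "Z \<in> \<T>" "Y \<in> mod_cat K A" "\<exists>f g. short_exact A X f Y g Z"
    then show "Y \<in> \<T>"
      by (elim exE) (rule assms(4))
  qed
qed

lemma torsion_class_zero_module:
  assumes T: "torsion_class K A \<T>" and Z: "Z \<in> mod_cat K A" "carrier Z = {\<zero>\<^bsub>Z\<^esub>}"
  shows "Z \<in> \<T>"
proof -
  obtain M where M: "M \<in> \<T>"
    using torsion_class_nonempty[OF T] by blast
  have lm: "left_module A M"
    using M torsion_class_subset[OF T] mod_catD by blast
  interpret M: left_module A M by fact
  have "zero_hom M Z ` carrier M = carrier Z"
    using Z(2) M.M.zero_closed by (auto simp: zero_hom_def)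
  then show ?thesis
    using torsion_class_quotient[OF T M Z(1) zero_hom_Hom[OF lm mod_catD[OF Z(1)]]] by simp
qed

text \<open>
  A zero module lies in every torsion class, so that intersections of torsion classes are nonempty.
\<close>

lemma zero_module_exists:
  obtains Z where "Z \<in> mod_cat K A" "carrier Z = {\<zero>\<^bsub>Z\<^esub>}"
proof -
  define z :: "nat \<Rightarrow> 'k" where "z = (\<lambda>_. \<zero>\<^bsub>K\<^esub>)"
  define Z :: "('a, nat \<Rightarrow> 'k) module" where
    "Z = \<lparr>carrier = {z}, monoid.mult = (\<lambda>_ _. z), one = z, zero = z, add = (\<lambda>_ _. z),
      smult = (\<lambda>_ _. z)\<rparr>"
  have "abelian_group Z"
    by (rule abelian_groupI) (auto simp: Z_def)
  then have lm: "left_module A Z"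
    by (simp add: left_module_def left_module_axioms_def A.ring_axioms Z_def)
  interpret Z: vectorspace K "underlying_space A Z"
    by (rule underlying_vectorspace[OF lm])
  have "Z.span {z} = carrier (underlying_space A Z)"
    using Z.in_own_span[of "{z}"] Z.span_is_subset2[of "{z}"] by (auto simp: Z_def)
  then have "Z.fin_dim"
    unfolding Z.fin_dim_def by (intro exI[of _ "{z}"]) (auto simp: Z_def)
  with lm that[of Z] show thesis
    by (simp add: mod_cat_def Z_def)
qed

lemma torsion_class_mod_cat: "torsion_class K A (mod_cat K A)"
  using zero_module_exists by (intro torsion_classI) auto

lemma torsion_class_Inter:
  assumes "\<And>\<T>. \<T> \<in> S \<Longrightarrow> torsion_class K A \<T>"
  shows "torsion_class K A (mod_cat K A \<inter> \<Inter>S)"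
proof (rule torsion_classI)
  obtain Z where "Z \<in> mod_cat K A" "carrier Z = {\<zero>\<^bsub>Z\<^esub>}"
    by (rule zero_module_exists)
  then show "mod_cat K A \<inter> \<Inter>S \<noteq> {}"
    using torsion_class_zero_module assms by blast
next
  fix M N g
  assume "M \<in> mod_cat K A \<inter> \<Inter>S" "N \<in> mod_cat K A" "g \<in> Hom A M N" "g ` carrier M = carrier N"
  then show "N \<in> mod_cat K A \<inter> \<Inter>S"
    using torsion_class_quotient[OF assms] by blast
next
  fix X Y Z f g
  assume "X \<in> mod_cat K A \<inter> \<Inter>S" "Z \<in> mod_cat K A \<inter> \<Inter>S" "Y \<in> mod_cat K A"
    "short_exact A X f Y g Z"
  then show "Y \<in> mod_cat K A \<inter> \<Inter>S"
    using torsion_class_extension[OF assms] by blast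
qed auto

definition generated_torsion_class ::
  "('a, nat \<Rightarrow> 'k) module \<Rightarrow> ('a, nat \<Rightarrow> 'k) module set" where
  "generated_torsion_class M = mod_cat K A \<inter> \<Inter>{\<T>. torsion_class K A \<T> \<and> M \<in> \<T>}"

lemma
  assumes "M \<in> mod_cat K A"
  shows torsion_class_generated: "torsion_class K A (generated_torsion_class M)"
    and mem_generated: "M \<in> generated_torsion_class M"
  using assms torsion_class_Inter[of "{\<T>. torsion_class K A \<T> \<and> M \<in> \<T>}"]
  by (auto simp: generated_torsion_class_def)

lemma generated_subset_iff:
  assumes "M \<in> mod_cat K A" "torsion_class K A \<T>"
  shows "generated_torsion_class M \<subseteq> \<T> \<longleftrightarrow> M \<in> \<T>"
  using assms mem_generated[OF assms(1)] by (auto simp: generated_torsion_class_def)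

definition left_perp :: "('a, nat \<Rightarrow> 'k) module \<Rightarrow> ('a, nat \<Rightarrow> 'k) module set" where
  "left_perp B = {X \<in> mod_cat K A. orthogonal A X B}"

text \<open>
  A homomorphism from the middle term of a short exact sequence either restricts to a nonzero one on
  the submodule or is induced from the quotient.  This is how closure under extensions is checked
  for classes that are defined by homomorphisms to \<open>B\<close>.
\<close>

lemma Hom_from_extension_cases:
  assumes X: "left_module A X" and Y: "left_module A Y" and Z: "left_module A Z"
    and B: "left_module A B" and se: "short_exact A X f Y g Z" and h: "h \<in> Hom A Y B"
  obtains x where "x \<in> carrier X" "compose (carrier X) h f \<in> Hom A X B" "h (f x) \<noteq> \<zero>\<^bsub>B\<^esub>"
  | h' where "h' \<in> Hom A Z B" "\<And>y. y \<in> carrier Y \<Longrightarrow> h' (g y) = h y"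
proof (cases "\<exists>x \<in> carrier X. h (f x) \<noteq> \<zero>\<^bsub>B\<^esub>")
  case True
  then show thesis
    using that(1) Hom_compose[OF X _ h] se by (auto simp: short_exact_def)
next
  case False
  have g: "g \<in> Hom A Y Z" "g ` carrier Y = carrier Z"
    and ker: "f ` carrier X = {y \<in> carrier Y. g y = \<zero>\<^bsub>Z\<^esub>}"
    using se by (auto simp: short_exact_def)
  have hk: "h y = \<zero>\<^bsub>B\<^esub>" if "y \<in> carrier Y" "g y = \<zero>\<^bsub>Z\<^esub>" for y
  proof -
    have "y \<in> f ` carrier X"
      using that ker by simp
    then show ?thesis
      using False by blast
  qed
  show thesis
    by (rule Hom_factor[OF Y Z B g h hk]) (blast intro: that(2))+
qed

lemma torsion_class_left_perp:
  assumes B: "B \<in> mod_cat K A"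
  shows "torsion_class K A (left_perp B)"
proof (rule torsion_classI)
  obtain Z where Z: "Z \<in> mod_cat K A" "carrier Z = {\<zero>\<^bsub>Z\<^esub>}"
    by (rule zero_module_exists)
  then have "Z \<in> left_perp B"
    using Hom_zero[OF mod_catD[OF Z(1)] mod_catD[OF B]] by (auto simp: left_perp_def orthogonal_def)
  then show "left_perp B \<noteq> {}" by blast
next
  fix M N g
  assume M: "M \<in> left_perp B" and N: "N \<in> mod_cat K A" and g: "g \<in> Hom A M N"
    "g ` carrier M = carrier N"
  have "h (g x) = \<zero>\<^bsub>B\<^esub>" if "h \<in> Hom A N B" "x \<in> carrier M" for h x
    using M that Hom_compose[OF mod_catD g(1) that(1)] compose_Hom_apply[of x M h g]
    by (force simp: left_perp_def orthogonal_def)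
  then show "N \<in> left_perp B"
    using N g(2) by (force simp: left_perp_def orthogonal_def)
next
  fix X Y Z f g
  assume X: "X \<in> left_perp B" and Z: "Z \<in> left_perp B" and Y: "Y \<in> mod_cat K A"
    and se: "short_exact A X f Y g Z"
  have lm: "left_module A X" "left_module A Y" "left_module A Z" "left_module A B"
    using X Y Z B by (auto simp: left_perp_def mod_catD)
  have gc: "g y \<in> carrier Z" if "y \<in> carrier Y" for y
    using that Hom_closed[of g A Y Z] se by (simp add: short_exact_def)
  have "h y = \<zero>\<^bsub>B\<^esub>" if h: "h \<in> Hom A Y B" and y: "y \<in> carrier Y" for h y
    using Hom_from_extension_cases[OF lm se h]
  proof cases
    case (1 x)
    then have "compose (carrier X) h f x = \<zero>\<^bsub>B\<^esub>"
      using X by (auto simp: left_perp_def orthogonal_def)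
    with 1 show ?thesis by (simp add: compose_def)
  next
    case (2 h')
    then have "h' (g y) = \<zero>\<^bsub>B\<^esub>"
      using Z gc[OF y] by (auto simp: left_perp_def orthogonal_def)
    with 2 y show ?thesis by simp
  qed
  then show "Y \<in> left_perp B"
    using Y by (auto simp: left_perp_def orthogonal_def)
qed (auto simp: left_perp_def)

text \<open>
  The modules all of whose homomorphisms to \<open>B\<close> are zero or surjective form a torsion class.  It
  contains \<open>B\<close> because \<open>B\<close> is a brick, and therefore it contains \<open>T(B)\<close>.
\<close>

lemma mem_generated_zero_or_surj:
  assumes B: "is_brick A B" "B \<in> mod_cat K A"
    and X: "X \<in> generated_torsion_class B" and f: "f \<in> Hom A X B"
  shows "(\<forall>x \<in> carrier X. f x = \<zero>\<^bsub>B\<^esub>) \<or> f ` carrier X = carrier B"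
proof -
  define zs where "zs M h \<longleftrightarrow> (\<forall>x \<in> carrier M. h x = \<zero>\<^bsub>B\<^esub>) \<or> h ` carrier M = carrier B"
    for M :: "('a, nat \<Rightarrow> 'k) module" and h :: "(nat \<Rightarrow> 'k) \<Rightarrow> (nat \<Rightarrow> 'k)"
  define D where "D = {M \<in> mod_cat K A. \<forall>h \<in> Hom A M B. zs M h}"
  have BD: "B \<in> D"
    using B is_brick_iff[OF mod_catD[OF B(2)]] by (auto simp: D_def zs_def bij_betw_def)
  have "torsion_class K A D"
  proof (rule torsion_classI)
    fix M N g
    assume M: "M \<in> D" and N: "N \<in> mod_cat K A" and g: "g \<in> Hom A M N" "g ` carrier M = carrier N"
    have "zs N h" if h: "h \<in> Hom A N B" for h
    proof -
      have lm: "left_module A M"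
        using M mod_catD by (auto simp: D_def)
      have "zs M (compose (carrier M) h g)"
        using M Hom_compose[OF lm g(1) h] by (simp add: D_def)
      then show ?thesis
        by (auto simp: zs_def compose_def g(2)[symmetric] image_image)
    qed
    then show "N \<in> D"
      using N by (simp add: D_def)
  next
    fix X Y Z f g
    assume X: "X \<in> D" and Z: "Z \<in> D" and Y: "Y \<in> mod_cat K A" and se: "short_exact A X f Y g Z"
    have lm: "left_module A X" "left_module A Y" "left_module A Z" "left_module A B"
      using X Y Z B by (auto simp: D_def mod_catD)
    have fc: "f x \<in> carrier Y" if "x \<in> carrier X" for x
      using that Hom_closed[of f A X Y] se by (simp add: short_exact_def)
    have gs: "g ` carrier Y = carrier Z"
      using se by (simp add: short_exact_def)
    have "zs Y h" if h: "h \<in> Hom A Y B" for h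
      using Hom_from_extension_cases[OF lm se h]
    proof cases
      case (1 x)
      then have "zs X (compose (carrier X) h f)" "compose (carrier X) h f x \<noteq> \<zero>\<^bsub>B\<^esub>"
        using X by (simp_all add: D_def compose_Hom_apply)
      then have "compose (carrier X) h f ` carrier X = carrier B"
        using 1(1) unfolding zs_def by blast
      then have "carrier B \<subseteq> h ` carrier Y"
        using fc by (auto simp: compose_def image_subset_iff)
      then show ?thesis
        using Hom_closed[OF h] by (auto simp: zs_def)
    next
      case (2 h')
      then have "zs Z h'"
        using Z by (simp add: D_def)
      then show ?thesis
        using 2 by (auto simp: zs_def gs[symmetric] image_image)
    qed
    then show "Y \<in> D"
      using Y by (simp add: D_def)
  qed (use BD in \<open>auto simp: D_def\<close>)
  then have "X \<in> D"
    using X BD by (auto simp: generated_torsion_class_def)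
  then show ?thesis
    using f by (simp add: D_def zs_def)
qed

text \<open>
  By the previous lemma \<open>B\<close> is a quotient of \<open>X\<close>.
\<close>

lemma brick_mem_of_generated:
  assumes B: "is_brick A B" "B \<in> mod_cat K A" and T: "torsion_class K A \<T>"
    and X: "X \<in> generated_torsion_class B" "X \<in> \<T>" "\<not> orthogonal A X B"
  shows "B \<in> \<T>"
proof -
  obtain f x where "f \<in> Hom A X B" "x \<in> carrier X" "f x \<noteq> \<zero>\<^bsub>B\<^esub>"
    using X(3) by (auto simp: orthogonal_def)
  then show ?thesis
    using mem_generated_zero_or_surj[OF B X(1)] torsion_class_quotient[OF T X(2) B(2)] by blast
qed

text \<open>
  Take for \<open>N\<close> the image in \<open>B\<close> of a nonzero homomorphism from \<open>X\<close>.  It is a quotient of \<open>X\<close>, hence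
  in \<open>\<T>\<close>, and \<open>B/N\<close> is a proper quotient of the brick \<open>B\<close>.
\<close>

lemma brick_extension_of_torsion:
  assumes B: "is_brick A B" "B \<in> mod_cat K A" and T: "torsion_class K A \<T>"
    and X: "X \<in> \<T>" "\<not> orthogonal A X B"
  obtains N Q i q where "N \<in> \<T>" "Q \<in> left_perp B" "short_exact A N i B q Q"
proof -
  obtain f x where f: "f \<in> Hom A X B" and x: "x \<in> carrier X" "f x \<noteq> \<zero>\<^bsub>B\<^esub>"
    using X(2) by (auto simp: orthogonal_def)
  have Xm: "X \<in> mod_cat K A"
    using X(1) torsion_class_subset[OF T] by blast
  obtain I i where I: "I \<in> mod_cat K A" "f \<in> Hom A X I" "f ` carrier X = carrier I"
    "i \<in> Hom A I B" "inj_on i (carrier I)" "\<And>y. y \<in> carrier I \<Longrightarrow> i y = y"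
    by (rule image_factorization[OF Xm B(2) f]) blast
  obtain Q q where Q: "Q \<in> mod_cat K A" "q \<in> Hom A B Q" "q ` carrier B = carrier Q"
    "{y \<in> carrier B. q y = \<zero>\<^bsub>Q\<^esub>} = f ` carrier X"
    by (rule quotient_mod_cat[OF B(2) submodule_set_image[OF mod_catD[OF Xm] mod_catD[OF B(2)] f]])
  have "q (f x) = \<zero>\<^bsub>Q\<^esub>" "f x \<in> carrier B"
    using Q(4) x(1) Hom_closed[OF f] by blast+
  then have "\<not> inj_on q (carrier B)"
    using x(2) Hom_inj_on_iff[OF mod_catD[OF B(2)] mod_catD[OF Q(1)] Q(2)] by blast
  then have "Q \<in> left_perp B"
    using brick_quotient_orthogonal[OF B Q(1-3)] Q(1) by (simp add: left_perp_def)
  moreover have "i ` carrier I = carrier I"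
    using I(6) by simp
  then have "short_exact A I i B q Q"
    using I Q by (simp add: short_exact_def)
  moreover have "I \<in> \<T>"
    by (rule torsion_class_quotient[OF T X(1) I(1-3)])
  ultimately show thesis
    using that by blast
qed

lemma right_perp_iff:
  assumes "\<T> \<subseteq> mod_cat K A"
  shows "X \<in> right_perp K A \<T> \<longleftrightarrow> X \<in> mod_cat K A \<and> (\<forall>M \<in> \<T>. orthogonal A M X)"
proof (cases "X \<in> mod_cat K A")
  case True
  have "Hom A M X = {zero_hom M X} \<longleftrightarrow> orthogonal A M X" if "M \<in> \<T>" for M
    using that assms True by (intro orthogonal_iff mod_catD) auto
  with True show ?thesis
    by (simp add: right_perp_def)
qed (simp add: right_perp_def)

lemma right_perp_iff_left_perp:
  assumes "torsion_class K A \<T>" "X \<in> mod_cat K A"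
  shows "X \<in> right_perp K A \<T> \<longleftrightarrow> \<T> \<subseteq> left_perp X"
  using assms right_perp_iff[OF torsion_class_subset[OF assms(1)], of X]
    torsion_class_subset[OF assms(1)] by (auto simp: left_perp_def)

lemma right_perp_sub:
  assumes T: "torsion_class K A \<T>" and X: "X \<in> right_perp K A \<T>" and Y: "Y \<in> mod_cat K A"
    and i: "i \<in> Hom A Y X" "inj_on i (carrier Y)"
  shows "Y \<in> right_perp K A \<T>"
proof -
  note perp = right_perp_iff[OF torsion_class_subset[OF T]]
  have Xm: "X \<in> mod_cat K A" and o: "\<And>M. M \<in> \<T> \<Longrightarrow> orthogonal A M X"
    using X perp by auto
  have "orthogonal A M Y" if "M \<in> \<T>" for M
    using orthogonal_sub[OF _ mod_catD[OF Y] mod_catD[OF Xm] i o[OF that]] that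
      torsion_class_subset[OF T] mod_catD by blast
  then show ?thesis
    using perp Y by blast
qed


text \<open>
  Every module is an extension of a torsion free module by a torsion module.  Choose \<open>N\<close> of largest
  dimension among the submodules of \<open>M\<close> that belong to \<open>\<T>\<close>.  A nonzero homomorphism from a
  member of \<open>\<T>\<close> to \<open>M/N\<close> has an image in \<open>\<T>\<close>, and the preimage of this image in \<open>M\<close> is an
  extension of it by \<open>N\<close>: a member of \<open>\<T>\<close> that is larger than \<open>N\<close>.
\<close>

lemma torsion_sequence:
  assumes T: "torsion_class K A \<T>" and M: "M \<in> mod_cat K A"
  obtains N Q i q where "N \<in> \<T>" "Q \<in> right_perp K A \<T>" "short_exact A N i M q Q"
proof -
  note lm = mod_catD[OF M]
  interpret M: left_module A M by fact
  define P where "P S \<longleftrightarrow> submodule_set A M S \<and> M\<lparr>carrier := S\<rparr> \<in> \<T>" for S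
  have "P {\<zero>\<^bsub>M\<^esub>}"
    using submodule_set_zero[OF lm] torsion_class_zero_module[OF T sub_mod_cat[OF M submodule_set_zero[OF lm]]]
    by (simp add: P_def)
  moreover have "mdim (M\<lparr>carrier := S\<rparr>) < Suc (mdim M)" if "P S" for S
    using mdim_sub_le[OF M, of S] that by (simp add: P_def less_Suc_eq_le)
  ultimately obtain N where N: "P N"
    and max: "\<And>S. P S \<Longrightarrow> mdim (M\<lparr>carrier := S\<rparr>) \<le> mdim (M\<lparr>carrier := N\<rparr>)"
    using ex_has_greatest_nat[of P "{\<zero>\<^bsub>M\<^esub>}" "\<lambda>S. mdim (M\<lparr>carrier := S\<rparr>)" "Suc (mdim M)"]
    by (metis less_imp_le)
  have Ns: "submodule_set A M N" and NT: "M\<lparr>carrier := N\<rparr> \<in> \<T>"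
    using N by (auto simp: P_def)
  obtain Q q where Q: "Q \<in> mod_cat K A" "q \<in> Hom A M Q" "q ` carrier M = carrier Q"
    "{x \<in> carrier M. q x = \<zero>\<^bsub>Q\<^esub>} = N"
    by (rule quotient_mod_cat[OF M Ns])
  note lmQ = mod_catD[OF Q(1)]
  interpret Q: left_module A Q by fact
  have "h x = \<zero>\<^bsub>Q\<^esub>" if X: "X \<in> \<T>" "h \<in> Hom A X Q" "x \<in> carrier X" for X h x
  proof (rule ccontr)
    assume nz: "h x \<noteq> \<zero>\<^bsub>Q\<^esub>"
    have Xm: "X \<in> mod_cat K A"
      using X(1) torsion_class_subset[OF T] by blast
    note lmX = mod_catD[OF Xm]
    have im: "submodule_set A Q (h ` carrier X)"
      by (rule submodule_set_image[OF lmX lmQ X(2)])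
    \<comment> \<open>The image of \<open>h\<close>, its preimage \<open>Y\<close> in \<open>M\<close>, and the sequence \<open>0 \<rightarrow> N \<rightarrow> Y \<rightarrow> I \<rightarrow> 0\<close>.\<close>
    define I where "I = Q\<lparr>carrier := h ` carrier X\<rparr>"
    have Im: "I \<in> mod_cat K A"
      using sub_mod_cat[OF Q(1) im] by (simp add: I_def)
    have hI: "h \<in> Hom A X I" "h ` carrier X = carrier I"
      unfolding I_def by (rule Hom_image_corestrict[OF X(2)]) simp
    have IT: "I \<in> \<T>"
      by (rule torsion_class_quotient[OF T X(1) Im hI])
    define S where "S = {y \<in> carrier M. q y \<in> h ` carrier X}"
    have S: "submodule_set A M S"
      unfolding S_def by (rule submodule_set_preimage[OF lm lmQ Q(2) im])
    define Y where "Y = M\<lparr>carrier := S\<rparr>"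
    have Ym: "Y \<in> mod_cat K A"
      using sub_mod_cat[OF M S] by (simp add: Y_def)
    have z: "\<zero>\<^bsub>Q\<^esub> \<in> h ` carrier X"
      using im by (simp add: submodule_set_def)
    have NS: "N \<subseteq> S"
      using Q(4) z by (auto simp: S_def)
    have "restrict q S \<in> Hom A Y I"
    proof (rule HomI)
      fix y1 y2 assume "y1 \<in> carrier Y" "y2 \<in> carrier Y"
      then show "restrict q S (y1 \<oplus>\<^bsub>Y\<^esub> y2) = restrict q S y1 \<oplus>\<^bsub>I\<^esub> restrict q S y2"
        using S Hom_add[OF Q(2)] by (auto simp: Y_def I_def submodule_set_def subset_iff)
    next
      fix a y assume "a \<in> carrier A" "y \<in> carrier Y"
      then show "restrict q S (a \<odot>\<^bsub>Y\<^esub> y) = a \<odot>\<^bsub>I\<^esub> restrict q S y"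
        using S Hom_smult[OF Q(2)] by (auto simp: Y_def I_def submodule_set_def subset_iff)
    qed (auto simp: Y_def I_def S_def)
    moreover have "restrict q S ` carrier Y = carrier I"
    proof -
      have "h ` carrier X \<subseteq> q ` carrier M"
        using Q(3) im by (simp add: submodule_set_def)
      then have "q ` S = h ` carrier X"
        unfolding S_def by (rule image_preimage_eq)
      then show ?thesis
        by (simp add: Y_def I_def)
    qed
    moreover have NY: "submodule_set A Y N"
      using Ns NS by (simp add: submodule_set_def Y_def)
    then have "(\<lambda>y \<in> N. y) \<in> Hom A (M\<lparr>carrier := N\<rparr>) Y"
      using inclusion_Hom[OF NY] by (simp add: Y_def)
    ultimately have "short_exact A (M\<lparr>carrier := N\<rparr>) (\<lambda>y \<in> N. y) Y (restrict q S) I"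
      using NS Q(4) by (auto simp: short_exact_def inj_on_def Y_def I_def S_def)
    then have "Y \<in> \<T>"
      by (rule torsion_class_extension[OF T NT IT Ym])
    then have "mdim Y \<le> mdim (M\<lparr>carrier := N\<rparr>)"
      using max[of S] S by (simp add: P_def Y_def)
    moreover have "N \<noteq> carrier Y"
    proof -
      have "h x \<in> q ` carrier M"
        using Q(3) Hom_closed[OF X(2,3)] by simp
      then obtain y where y: "y \<in> carrier M" "h x = q y"
        by (rule imageE) simp
      have "q y \<in> h ` carrier X"
        by (rule image_eqI[where x = x]) (simp_all add: y(2) X(3))
      then have "y \<in> S" "y \<notin> N"
        using y nz Q(4) by (auto simp: S_def)
      then show ?thesis
        by (auto simp: Y_def)
    qed
    then have "mdim (M\<lparr>carrier := N\<rparr>) < mdim Y"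
      using mdim_sub_less[OF Ym NY] by (simp add: Y_def)
    ultimately show False by simp
  qed
  then have "Q \<in> right_perp K A \<T>"
    using right_perp_iff[OF torsion_class_subset[OF T]] Q(1) by (auto simp: orthogonal_def)
  moreover have "short_exact A (M\<lparr>carrier := N\<rparr>) (\<lambda>y \<in> N. y) M q Q"
    using Q inclusion_Hom[OF Ns] by (auto simp: short_exact_def inj_on_def)
  ultimately show thesis
    using that NT by blast
qed

lemma nonzero_torsion_free_quotient:
  assumes T: "torsion_class K A \<T>" and M: "M \<in> mod_cat K A" "M \<notin> \<T>"
  obtains Q q where "Q \<in> right_perp K A \<T>" "carrier Q \<noteq> {\<zero>\<^bsub>Q\<^esub>}"
    "q \<in> Hom A M Q" "q ` carrier M = carrier Q"
proof -
  obtain N Q i q where s: "N \<in> \<T>" "Q \<in> right_perp K A \<T>" "short_exact A N i M q Q"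
    by (rule torsion_sequence[OF T M(1)])
  have "carrier Q \<noteq> {\<zero>\<^bsub>Q\<^esub>}"
  proof
    assume "carrier Q = {\<zero>\<^bsub>Q\<^esub>}"
    moreover have "q x \<in> carrier Q" if "x \<in> carrier M" for x
      using that s(3) by (auto simp: short_exact_def)
    ultimately have "i ` carrier N = carrier M"
      using s(3) by (auto simp: short_exact_def)
    then have "M \<in> \<T>"
      using torsion_class_quotient[OF T s(1) M(1), of i] s(3) by (simp add: short_exact_def)
    with M(2) show False by simp
  qed
  then show thesis
    using that s by (auto simp: short_exact_def)
qed

text \<open>
  Bricks detect inclusions of torsion classes: a module in \<open>\<T>\<^sub>1\<close> but not in \<open>\<T>\<^sub>2\<close> has a
  nonzero quotient in \<open>\<T>\<^sub>2\<^sup>\<bottom>\<close>, and in \<open>\<T>\<^sub>1 \<inter> \<T>\<^sub>2\<^sup>\<bottom>\<close> images of endomorphisms are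
  quotients of a torsion module and submodules of a torsion free one.
\<close>

lemma brick_of_not_subset:
  assumes T1: "torsion_class K A \<T>\<^sub>1" and T2: "torsion_class K A \<T>\<^sub>2" and "\<not> \<T>\<^sub>1 \<subseteq> \<T>\<^sub>2"
  obtains B where "is_brick A B" "B \<in> \<T>\<^sub>1" "B \<in> right_perp K A \<T>\<^sub>2"
proof -
  obtain M where M: "M \<in> \<T>\<^sub>1" "M \<notin> \<T>\<^sub>2"
    using assms(3) by blast
  have Mm: "M \<in> mod_cat K A"
    using M(1) torsion_class_subset[OF T1] by blast
  obtain Q q where Q: "Q \<in> right_perp K A \<T>\<^sub>2" "carrier Q \<noteq> {\<zero>\<^bsub>Q\<^esub>}"
    "q \<in> Hom A M Q" "q ` carrier M = carrier Q"
    by (rule nonzero_torsion_free_quotient[OF T2 Mm M(2)])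
  have Qm: "Q \<in> mod_cat K A"
    using Q(1) by (simp add: right_perp_def)
  have "Q \<in> \<T>\<^sub>1 \<inter> right_perp K A \<T>\<^sub>2"
    using Q(1) torsion_class_quotient[OF T1 M(1) Qm Q(3,4)] by blast
  moreover have "\<T>\<^sub>1 \<inter> right_perp K A \<T>\<^sub>2 \<subseteq> mod_cat K A"
    by (auto simp: right_perp_def)
  ultimately obtain B where "B \<in> \<T>\<^sub>1 \<inter> right_perp K A \<T>\<^sub>2" "is_brick A B"
    using Q(2) torsion_class_quotient[OF T1] right_perp_sub[OF T2]
    by (elim brick_of_minimal_dimension[where \<C> = "\<T>\<^sub>1 \<inter> right_perp K A \<T>\<^sub>2"]) blast+
  then show thesis
    using that by blast
qed

text \<open>
  A variant with prescribed \<open>M\<close>: among the torsion free quotients of \<open>M\<close>, a nonzero one of least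
  dimension is a brick.
\<close>

lemma brick_quotient_of_not_mem:
  assumes T: "torsion_class K A \<T>" and M: "M \<in> mod_cat K A" "M \<notin> \<T>"
  obtains B where "is_brick A B" "B \<in> right_perp K A \<T>" "M \<notin> left_perp B"
proof -
  define C where "C = {X \<in> right_perp K A \<T>. \<exists>p \<in> Hom A M X. p ` carrier M = carrier X}"
  obtain Q q where Q: "Q \<in> right_perp K A \<T>" "carrier Q \<noteq> {\<zero>\<^bsub>Q\<^esub>}"
    "q \<in> Hom A M Q" "q ` carrier M = carrier Q"
    by (rule nonzero_torsion_free_quotient[OF T M])
  have "C \<subseteq> mod_cat K A" "Q \<in> C"
    using Q by (auto simp: C_def right_perp_def)
  moreover have "I \<in> C" if X: "X \<in> C" and I: "I \<in> mod_cat K A"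
    and p: "p \<in> Hom A X I" "p ` carrier X = carrier I" and i: "i \<in> Hom A I X" "inj_on i (carrier I)"
    for X I p i
  proof -
    obtain r where r: "r \<in> Hom A M X" "r ` carrier M = carrier X" and Xp: "X \<in> right_perp K A \<T>"
      using X by (auto simp: C_def)
    have "compose (carrier M) p r ` carrier M = carrier I"
      by (simp add: compose_def p(2)[symmetric] r(2)[symmetric] image_image)
    then show ?thesis
      using Hom_compose[OF mod_catD[OF M(1)] r(1) p(1)] right_perp_sub[OF T Xp I i]
      by (auto simp: C_def)
  qed
  ultimately obtain B where B: "B \<in> C" "is_brick A B"
    using Q(2) brick_of_minimal_dimension[of C Q] by metis
  then obtain p where p: "p \<in> Hom A M B" "p ` carrier M = carrier B"
    by (auto simp: C_def)
  have Bm: "B \<in> mod_cat K A"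
    using B(1) by (auto simp: C_def right_perp_def)
  interpret B: left_module A B
    by (rule mod_catD[OF Bm])
  obtain y where y: "y \<in> carrier B" "y \<noteq> \<zero>\<^bsub>B\<^esub>"
    using B(2) is_brick_iff[OF mod_catD[OF Bm]] B.M.zero_closed by blast
  then have "y \<in> p ` carrier M"
    using p(2) by simp
  then obtain x where "x \<in> carrier M" "p x \<noteq> \<zero>\<^bsub>B\<^esub>"
    using y(2) by blast
  then have "M \<notin> left_perp B"
    using p(1) by (auto simp: left_perp_def orthogonal_def)
  then show thesis
    using that B by (auto simp: C_def)
qed

text \<open>
  Dually, among the submodules of \<open>M\<close> that belong to \<open>\<T>\<close>, a nonzero one of least dimension is a
  brick.
\<close>

lemma torsion_brick_submodule:
  assumes T: "torsion_class K A \<T>" and M: "M \<in> mod_cat K A" "M \<notin> right_perp K A \<T>"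
  obtains B where "is_brick A B" "B \<in> \<T>" "\<not> orthogonal A B M"
proof -
  define C where "C = {X \<in> \<T>. \<exists>j \<in> Hom A X M. inj_on j (carrier X)}"
  obtain X f x where X: "X \<in> \<T>" "f \<in> Hom A X M" "x \<in> carrier X" "f x \<noteq> \<zero>\<^bsub>M\<^esub>"
    using M right_perp_iff[OF torsion_class_subset[OF T]] by (auto simp: orthogonal_def)
  have Xm: "X \<in> mod_cat K A"
    using X(1) torsion_class_subset[OF T] by blast
  obtain I i where I: "I \<in> mod_cat K A" "f \<in> Hom A X I" "f ` carrier X = carrier I"
    "i \<in> Hom A I M" "inj_on i (carrier I)" "\<zero>\<^bsub>I\<^esub> = \<zero>\<^bsub>M\<^esub>"
    by (rule image_factorization[OF Xm M(1) X(2)]) blast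
  \<comment> \<open>The image of \<open>f\<close> is a nonzero member of \<open>C\<close>.\<close>
  have "C \<subseteq> mod_cat K A" "I \<in> C" "carrier I \<noteq> {\<zero>\<^bsub>I\<^esub>}"
    using torsion_class_subset[OF T] torsion_class_quotient[OF T X(1) I(1-3)] I X(3,4)
    by (auto simp: C_def)
  moreover have "J \<in> C" if Y: "Y \<in> C" and J: "J \<in> mod_cat K A"
    and p: "p \<in> Hom A Y J" "p ` carrier Y = carrier J" and l: "l \<in> Hom A J Y" "inj_on l (carrier J)"
    for Y J p l
  proof -
    obtain j where j: "j \<in> Hom A Y M" "inj_on j (carrier Y)" and YT: "Y \<in> \<T>"
      using Y by (auto simp: C_def)
    have "inj_on (compose (carrier J) j l) (carrier J)"
      using j(2) l(2) Hom_closed[OF l(1)] by (auto simp: inj_on_def compose_def)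
    then show ?thesis
      using Hom_compose[OF mod_catD[OF J] l(1) j(1)] torsion_class_quotient[OF T YT J p]
      by (auto simp: C_def)
  qed
  ultimately obtain B where B: "B \<in> C" "is_brick A B"
    using brick_of_minimal_dimension[of C I] by metis
  then obtain j where j: "j \<in> Hom A B M" "inj_on j (carrier B)" and BT: "B \<in> \<T>"
    by (auto simp: C_def)
  have Bm: "B \<in> mod_cat K A"
    using BT torsion_class_subset[OF T] by blast
  interpret B: left_module A B
    by (rule mod_catD[OF Bm])
  obtain y where y: "y \<in> carrier B" "y \<noteq> \<zero>\<^bsub>B\<^esub>"
    using B(2) is_brick_iff[OF mod_catD[OF Bm]] B.M.zero_closed by blast
  then have "j y \<noteq> \<zero>\<^bsub>M\<^esub>"
    using j Hom_inj_on_iff[OF mod_catD[OF Bm] mod_catD[OF M(1)] j(1)] by blast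
  then have "\<not> orthogonal A B M"
    using j(1) y(1) by (auto simp: orthogonal_def)
  then show thesis
    using that B(2) BT by blast
qed


section \<open>The lattice of torsion classes\<close>

lemma carrier_tors [simp]: "\<T> \<in> carrier (tors K A) \<longleftrightarrow> torsion_class K A \<T>"
  and le_tors [simp]: "\<T> \<sqsubseteq>\<^bsub>tors K A\<^esub> \<T>' \<longleftrightarrow> \<T> \<subseteq> \<T>'"
  and lless_tors [simp]: "\<T> \<sqsubset>\<^bsub>tors K A\<^esub> \<T>' \<longleftrightarrow> \<T> \<subset> \<T>'"
  by (auto simp: tors_def lless_def)

text \<open>
  Arbitrary intersections of torsion classes are torsion classes; \<open>mod A\<close> itself is the largest
  one.
\<close>

lemma complete_lattice_tors: "complete_lattice (tors K A)"
proof -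
  interpret partial_order "tors K A"
    by unfold_locales (auto simp: tors_def)
  show ?thesis
  proof (rule complete_lattice_criterion1)
    show "\<exists>g. greatest (tors K A) g (carrier (tors K A))"
      using torsion_class_mod_cat torsion_class_subset
      by (intro exI[of _ "mod_cat K A"]) (simp add: greatest_def)
    fix S assume S: "S \<subseteq> carrier (tors K A)"
    have tc: "torsion_class K A \<T>" if "\<T> \<in> S" for \<T>
      using S that by (auto simp: tors_def)
    have "torsion_class K A (mod_cat K A \<inter> \<Inter>S)"
      by (rule torsion_class_Inter) (rule tc)
    then show "\<exists>i. greatest (tors K A) i (Lower (tors K A) S)"
      using tc torsion_class_subset
      by (intro exI[of _ "mod_cat K A \<inter> \<Inter>S"]) (auto simp: greatest_def Lower_def)
  qed
qed

lemma
  assumes S: "\<And>\<T>. \<T> \<in> S \<Longrightarrow> torsion_class K A \<T>"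
  shows torsion_class_sup: "torsion_class K A (\<Squnion>\<^bsub>tors K A\<^esub> S)"
    and sup_tors_upper: "\<T> \<in> S \<Longrightarrow> \<T> \<subseteq> \<Squnion>\<^bsub>tors K A\<^esub> S"
    and sup_tors_least: "\<lbrakk>torsion_class K A \<U>; \<And>\<T>. \<T> \<in> S \<Longrightarrow> \<T> \<subseteq> \<U>\<rbrakk> \<Longrightarrow> \<Squnion>\<^bsub>tors K A\<^esub> S \<subseteq> \<U>"
    and inf_tors: "\<Sqinter>\<^bsub>tors K A\<^esub> S = mod_cat K A \<inter> \<Inter>S"
proof -
  interpret L: complete_lattice "tors K A"
    by (rule complete_lattice_tors)
  have S': "S \<subseteq> carrier (tors K A)"
    using S by (auto simp: tors_def)
  show "torsion_class K A (\<Squnion>\<^bsub>tors K A\<^esub> S)"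
    using L.sup_closed[OF S'] by simp
  show "\<T> \<subseteq> \<Squnion>\<^bsub>tors K A\<^esub> S" if "\<T> \<in> S"
    using L.sup_upper[OF S' that] by simp
  show "\<Squnion>\<^bsub>tors K A\<^esub> S \<subseteq> \<U>" if "torsion_class K A \<U>" "\<And>\<T>. \<T> \<in> S \<Longrightarrow> \<T> \<subseteq> \<U>"
    using L.sup_least[OF S', of \<U>] that by simp
  have "torsion_class K A (\<Sqinter>\<^bsub>tors K A\<^esub> S)"
    using L.inf_closed[OF S'] by simp
  moreover have "\<Sqinter>\<^bsub>tors K A\<^esub> S \<subseteq> \<T>" if "\<T> \<in> S" for \<T>
    using L.inf_lower[OF S' that] by simp
  moreover have "mod_cat K A \<inter> \<Inter>S \<subseteq> \<Sqinter>\<^bsub>tors K A\<^esub> S"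
    using L.inf_greatest[OF S', of "mod_cat K A \<inter> \<Inter>S"] torsion_class_Inter[OF S] by auto
  ultimately show "\<Sqinter>\<^bsub>tors K A\<^esub> S = mod_cat K A \<inter> \<Inter>S"
    using torsion_class_subset by blast
qed

lemma
  assumes T: "torsion_class K A \<T>" and U: "torsion_class K A \<U>"
  shows torsion_class_join: "torsion_class K A (\<T> \<squnion>\<^bsub>tors K A\<^esub> \<U>)"
    and join_tors_left: "\<T> \<subseteq> \<T> \<squnion>\<^bsub>tors K A\<^esub> \<U>"
    and join_tors_right: "\<U> \<subseteq> \<T> \<squnion>\<^bsub>tors K A\<^esub> \<U>"
    and join_tors_least:
      "\<lbrakk>torsion_class K A \<V>; \<T> \<subseteq> \<V>; \<U> \<subseteq> \<V>\<rbrakk> \<Longrightarrow> \<T> \<squnion>\<^bsub>tors K A\<^esub> \<U> \<subseteq> \<V>"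
    and meet_tors: "\<T> \<sqinter>\<^bsub>tors K A\<^esub> \<U> = \<T> \<inter> \<U>"
    and torsion_class_Int: "torsion_class K A (\<T> \<inter> \<U>)"
proof -
  have tc: "torsion_class K A \<V>" if "\<V> \<in> {\<T>, \<U>}" for \<V>
    using that T U by blast
  show "torsion_class K A (\<T> \<squnion>\<^bsub>tors K A\<^esub> \<U>)"
    unfolding join_def by (rule torsion_class_sup) (rule tc)
  show "\<T> \<subseteq> \<T> \<squnion>\<^bsub>tors K A\<^esub> \<U>" "\<U> \<subseteq> \<T> \<squnion>\<^bsub>tors K A\<^esub> \<U>"
    unfolding join_def by (rule sup_tors_upper, erule tc, simp)+
  show "\<T> \<squnion>\<^bsub>tors K A\<^esub> \<U> \<subseteq> \<V>" if "torsion_class K A \<V>" "\<T> \<subseteq> \<V>" "\<U> \<subseteq> \<V>"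
    unfolding join_def by (rule sup_tors_least) (use that tc in auto)
  have eq: "mod_cat K A \<inter> \<Inter>{\<T>, \<U>} = \<T> \<inter> \<U>"
    using torsion_class_subset[OF T] by auto
  show "\<T> \<sqinter>\<^bsub>tors K A\<^esub> \<U> = \<T> \<inter> \<U>"
    unfolding meet_def using inf_tors[of "{\<T>, \<U>}", OF tc] eq by simp
  show "torsion_class K A (\<T> \<inter> \<U>)"
    using torsion_class_Inter[of "{\<T>, \<U>}", OF tc] eq by simp
qed

section \<open>Left modular torsion classes\<close>

lemma brick_not_in_torsion_and_right_perp:
  assumes "torsion_class K A \<T>" "is_brick A B" "B \<in> \<T>"
  shows "B \<notin> right_perp K A \<T>"
  using assms brick_not_orthogonal_self[OF assms(2)] torsion_class_subset[OF assms(1)]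
    right_perp_iff[OF torsion_class_subset[OF assms(1)], of B] by blast

text \<open>
  The inclusion that does not hold in every lattice is tested on a brick \<open>B\<close> that lies in the left
  hand side and is perpendicular to the right hand side.  If \<open>B\<close> were in \<open>\<T>\<close>, it would be in
  \<open>\<T> \<inter> \<Z>\<close>, hence in the right hand side.  If \<open>B\<close> were in \<open>\<T>\<^sup>\<bottom>\<close>, then \<open>\<^sup>\<bottom>B\<close> would contain both
  \<open>\<Y>\<close> and \<open>\<T>\<close> and therefore \<open>B\<close>.
\<close>

lemma brick_splitting_left_modular:
  assumes "brick_splitting K A \<T>"
  shows "left_modular_element (tors K A) \<T>"
proof -
  have T: "torsion_class K A \<T>"
    and split: "\<And>B. \<lbrakk>B \<in> mod_cat K A; is_brick A B\<rbrakk> \<Longrightarrow> B \<in> \<T> \<or> B \<in> right_perp K A \<T>"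
    using assms by (auto simp: brick_splitting_def)
  have "(\<Y> \<squnion>\<^bsub>tors K A\<^esub> \<T>) \<sqinter>\<^bsub>tors K A\<^esub> \<Z> = \<Y> \<squnion>\<^bsub>tors K A\<^esub> (\<T> \<sqinter>\<^bsub>tors K A\<^esub> \<Z>)"
    if Y: "torsion_class K A \<Y>" and Z: "torsion_class K A \<Z>" and YZ: "\<Y> \<subseteq> \<Z>" for \<Y> \<Z>
  proof -
    note YT = torsion_class_join[OF Y T] and TZ = torsion_class_Int[OF T Z]
    let ?l = "(\<Y> \<squnion>\<^bsub>tors K A\<^esub> \<T>) \<inter> \<Z>" and ?r = "\<Y> \<squnion>\<^bsub>tors K A\<^esub> (\<T> \<inter> \<Z>)"
    have l: "torsion_class K A ?l" and r: "torsion_class K A ?r"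
      using torsion_class_Int[OF YT Z] torsion_class_join[OF Y TZ] .
    have "?r \<subseteq> ?l"
      using join_tors_least[OF Y TZ l] join_tors_left[OF Y T] join_tors_right[OF Y T] YZ by blast
    moreover have "?l \<subseteq> ?r"
    proof (rule ccontr)
      assume "\<not> ?l \<subseteq> ?r"
      then obtain B where B: "is_brick A B" "B \<in> ?l" "B \<in> right_perp K A ?r"
        by (rule brick_of_not_subset[OF l r])
      have Bm: "B \<in> mod_cat K A"
        using B(3) by (simp add: right_perp_def)
      have rB: "?r \<subseteq> left_perp B"
        using B(3) right_perp_iff_left_perp[OF r Bm] by simp
      have "B \<notin> left_perp B"
        using brick_not_orthogonal_self[OF B(1) Bm] by (simp add: left_perp_def)
      then have "B \<notin> \<T>"
        using rB B(2) join_tors_right[OF Y TZ] by blast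
      then have "\<T> \<subseteq> left_perp B"
        using split[OF Bm B(1)] right_perp_iff_left_perp[OF T Bm] by simp
      moreover have "\<Y> \<subseteq> left_perp B"
        using rB join_tors_left[OF Y TZ] by blast
      ultimately have "\<Y> \<squnion>\<^bsub>tors K A\<^esub> \<T> \<subseteq> left_perp B"
        by (intro join_tors_least[OF Y T torsion_class_left_perp[OF Bm]])
      with B(2) \<open>B \<notin> left_perp B\<close> show False by blast
    qed
    ultimately have "?l = ?r"
      by (rule equalityI[rotated])
    then show ?thesis
      by (simp add: meet_tors[OF T Z] meet_tors[OF YT Z])
  qed
  then show ?thesis
    using T by (simp add: left_modular_element_def)
qed

text \<open>
  Suppose that the brick \<open>B\<close> is an extension of \<open>Q \<in> \<^sup>\<bottom>B\<close> by \<open>N \<in> \<T>\<close> but not in \<open>\<T>\<close> itself.  For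
  \<open>\<Y> = T(Q)\<close> and \<open>\<Z> = T(B)\<close> the class \<open>(\<Y> \<squnion> \<T>) \<sqinter> \<Z>\<close> contains \<open>B\<close>.  On the other hand
  \<open>\<T> \<inter> T(B) \<subseteq> \<^sup>\<bottom>B\<close>, since otherwise \<open>B\<close> would be a quotient of a member of \<open>\<T>\<close>; so
  \<open>\<Y> \<squnion> (\<T> \<sqinter> \<Z>)\<close> is contained in \<open>\<^sup>\<bottom>B\<close>.
\<close>

lemma left_modular_brick_splitting:
  assumes "left_modular_element (tors K A) \<T>"
  shows "brick_splitting K A \<T>"
proof -
  have T: "torsion_class K A \<T>"
    using assms by (simp add: left_modular_element_def)
  have "B \<in> \<T> \<or> B \<in> right_perp K A \<T>" if B: "is_brick A B" and Bm: "B \<in> mod_cat K A" for B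
  proof (rule ccontr)
    assume "\<not> (B \<in> \<T> \<or> B \<in> right_perp K A \<T>)"
    then have BT: "B \<notin> \<T>" and "B \<notin> right_perp K A \<T>" by auto
    then obtain X where X: "X \<in> \<T>" "\<not> orthogonal A X B"
      using right_perp_iff[OF torsion_class_subset[OF T]] Bm by blast
    obtain N Q i q where N: "N \<in> \<T>" and Q: "Q \<in> left_perp B" and se: "short_exact A N i B q Q"
      by (rule brick_extension_of_torsion[OF B Bm T X])
    have Qm: "Q \<in> mod_cat K A"
      using Q by (simp add: left_perp_def)
    define \<Y> where "\<Y> = generated_torsion_class Q"
    define \<Z> where "\<Z> = generated_torsion_class B"
    have Y: "torsion_class K A \<Y>" and QY: "Q \<in> \<Y>"
      and Z: "torsion_class K A \<Z>" and BZ: "B \<in> \<Z>"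
      using torsion_class_generated mem_generated Qm Bm by (simp_all add: \<Y>_def \<Z>_def)
    have "Q \<in> \<Z>"
      using torsion_class_quotient[OF Z BZ Qm, of q] se by (simp add: short_exact_def)
    then have "\<Y> \<subseteq> \<Z>"
      using generated_subset_iff[OF Qm Z] by (simp add: \<Y>_def)
    then have eq: "(\<Y> \<squnion>\<^bsub>tors K A\<^esub> \<T>) \<inter> \<Z> = \<Y> \<squnion>\<^bsub>tors K A\<^esub> (\<T> \<inter> \<Z>)"
      using assms Y Z meet_tors[OF T Z] meet_tors[OF torsion_class_join[OF Y T] Z]
      by (simp add: left_modular_element_def)
    have "B \<in> \<Y> \<squnion>\<^bsub>tors K A\<^esub> \<T>"
      using torsion_class_extension[OF torsion_class_join[OF Y T] _ _ Bm se] N QY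
        join_tors_left[OF Y T] join_tors_right[OF Y T] by blast
    then have BR: "B \<in> \<Y> \<squnion>\<^bsub>tors K A\<^esub> (\<T> \<inter> \<Z>)"
      using eq BZ by blast
    have perp: "torsion_class K A (left_perp B)"
      by (rule torsion_class_left_perp[OF Bm])
    have "\<Y> \<subseteq> left_perp B"
      using generated_subset_iff[OF Qm perp] Q by (simp add: \<Y>_def)
    moreover have "\<T> \<inter> \<Z> \<subseteq> left_perp B"
    proof
      fix M assume M: "M \<in> \<T> \<inter> \<Z>"
      have "orthogonal A M B"
        using brick_mem_of_generated[OF B Bm T, of M] M BT by (auto simp: \<Z>_def)
      then show "M \<in> left_perp B"
        using M torsion_class_subset[OF T] by (auto simp: left_perp_def)
    qed
    ultimately have "\<Y> \<squnion>\<^bsub>tors K A\<^esub> (\<T> \<inter> \<Z>) \<subseteq> left_perp B"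
      by (rule join_tors_least[OF Y torsion_class_Int[OF T Z] perp])
    then show False
      using BR brick_not_orthogonal_self[OF B Bm] by (auto simp: left_perp_def)
  qed
  then show ?thesis
    using T by (simp add: brick_splitting_def)
qed

lemma module_iso_refl: "M \<in> mod_cat K A \<Longrightarrow> module_iso A M M"
  unfolding module_iso_def
  by (rule bexI[OF _ id_Hom[OF mod_catD]]) (auto simp: bij_betw_def inj_on_def)

lemma iso_class_subset_iff:
  assumes "torsion_class K A \<T>" "M \<in> mod_cat K A"
  shows "iso_class K A M \<subseteq> \<T> \<longleftrightarrow> M \<in> \<T>"
  using assms module_iso_refl[OF assms(2)] torsion_class_iso[OF assms(1)]
  by (auto simp: iso_class_def)

lemma brick_splitting_successor_closed:
  assumes "brick_splitting K A \<T>"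
  shows "successor_closed (brick_quiver K A) (bricks_in K A \<T>)"
proof -
  have T: "torsion_class K A \<T>"
    and split: "\<And>B. \<lbrakk>B \<in> mod_cat K A; is_brick A B\<rbrakk> \<Longrightarrow> B \<in> \<T> \<or> B \<in> right_perp K A \<T>"
    using assms by (auto simp: brick_splitting_def)
  have "Y \<in> bricks_in K A \<T>" if X: "X \<in> bricks_in K A \<T>" and Y: "Y \<in> brick K A"
    and M: "M \<in> X" and N: "N \<in> Y" and hom: "Hom A M N \<noteq> {zero_hom M N}" for X Y M N
  proof -
    obtain B where B: "B \<in> mod_cat K A" "is_brick A B" "Y = iso_class K A B"
      using Y by (auto simp: brick_def)
    have MT: "M \<in> \<T>"
      using X M by (auto simp: bricks_in_def)
    then have lmM: "left_module A M"
      using torsion_class_subset[OF T] mod_catD by blast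
    have Nm: "N \<in> mod_cat K A" and "module_iso A B N"
      using N B(3) by (auto simp: iso_class_def)
    then obtain f where f: "f \<in> Hom A B N" "bij_betw f (carrier B) (carrier N)"
      by (auto simp: module_iso_def)
    \<comment> \<open>The vertex \<open>Y\<close> is the class of the brick \<open>B\<close>, but the arrow is given by a map to some \<open>N \<cong> B\<close>.\<close>
    obtain g where g: "g \<in> Hom A N B" "inj_on g (carrier N)"
      by (rule Hom_inverse[OF mod_catD[OF B(1)] mod_catD[OF Nm] f]) (auto simp: bij_betw_def)
    have "\<not> orthogonal A M N"
      using hom orthogonal_iff[OF lmM mod_catD[OF Nm]] by simp
    then have "\<not> orthogonal A M B"
      using orthogonal_sub[OF lmM mod_catD[OF Nm] mod_catD[OF B(1)] g] by blast
    then have "B \<in> \<T>"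
      using split[OF B(1,2)] right_perp_iff[OF torsion_class_subset[OF T]] MT by blast
    then show ?thesis
      using Y B iso_class_subset_iff[OF T B(1)] by (simp add: bricks_in_def)
  qed
  then have "j \<in> bricks_in K A \<T>"
    if "(i, j) \<in> parcs (brick_quiver K A) \<and> i \<in> bricks_in K A \<T>" for i j
    using that unfolding brick_quiver_def by (simp, blast)
  moreover have "bricks_in K A \<T> \<subseteq> pverts (brick_quiver K A)"
    by (auto simp: bricks_in_def brick_quiver_def)
  ultimately show ?thesis
    by (simp add: successor_closed_def)
qed

text \<open>
  A brick outside \<open>\<T>\<^sup>\<bottom>\<close> receives a nonzero homomorphism from a brick in \<open>\<T>\<close>, which is an arrow of
  the brick quiver unless the two bricks are isomorphic.
\<close>

lemma successor_closed_brick_splitting: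
  assumes T: "torsion_class K A \<T>"
    and sc: "successor_closed (brick_quiver K A) (bricks_in K A \<T>)"
  shows "brick_splitting K A \<T>"
proof -
  have "B \<in> \<T>" if B: "is_brick A B" and Bm: "B \<in> mod_cat K A" and nB: "B \<notin> right_perp K A \<T>" for B
  proof -
    obtain X where X: "is_brick A X" "X \<in> \<T>" "\<not> orthogonal A X B"
      by (rule torsion_brick_submodule[OF T Bm nB])
    have Xm: "X \<in> mod_cat K A"
      using X(2) torsion_class_subset[OF T] by blast
    let ?X = "iso_class K A X" and ?B = "iso_class K A B"
    have inX: "X \<in> ?X" and inB: "B \<in> ?B"
      using Xm Bm module_iso_refl by (auto simp: iso_class_def)
    have bX: "?X \<in> brick K A" and bB: "?B \<in> brick K A"
      using X(1) Xm B Bm by (auto simp: brick_def)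
    have XT: "?X \<in> bricks_in K A \<T>"
      using bX X(2) iso_class_subset_iff[OF T Xm] by (simp add: bricks_in_def)
    show "B \<in> \<T>"
    proof (cases "?X = ?B")
      case True
      then show ?thesis
        using XT inB by (auto simp: bricks_in_def)
    next
      case False
      have "Hom A X B \<noteq> {zero_hom X B}"
        using X(3) orthogonal_iff[OF mod_catD[OF Xm] mod_catD[OF Bm]] by simp
      then have "(?X, ?B) \<in> parcs (brick_quiver K A)"
        using False bX bB inX inB by (auto simp: brick_quiver_def)
      then have "?B \<in> bricks_in K A \<T>"
        using sc XT by (auto simp: successor_closed_def)
      then show ?thesis
        using inB by (auto simp: bricks_in_def)
    qed
  qed
  then show ?thesis
    using T by (auto simp: brick_splitting_def)
qed

section \<open>Join- and meet-irreducible torsion classes\<close>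

text \<open>
  A torsion class inside \<open>T(B)\<close> with a member outside \<open>\<^sup>\<bottom>B\<close> has \<open>B\<close> as a member, hence is all of
  \<open>T(B)\<close>.  Thus \<open>T(B) \<inter> \<^sup>\<bottom>B\<close> is the largest torsion class strictly below \<open>T(B)\<close>.
\<close>

lemma proper_subclass_of_generated:
  assumes B: "is_brick A B" "B \<in> mod_cat K A" and T: "torsion_class K A \<T>"
    and sub: "\<T> \<subset> generated_torsion_class B"
  shows "\<T> \<subseteq> left_perp B"
proof
  fix X assume X: "X \<in> \<T>"
  have "B \<notin> \<T>"
    using sub generated_subset_iff[OF B(2) T] by blast
  then have "orthogonal A X B"
    using brick_mem_of_generated[OF B T _ X] X sub by blast
  then show "X \<in> left_perp B"
    using X torsion_class_subset[OF T] by (auto simp: left_perp_def)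
qed

lemma brick_not_in_left_perp:
  assumes "is_brick A B" "B \<in> mod_cat K A"
  shows "B \<notin> left_perp B"
  using brick_not_orthogonal_self[OF assms] by (simp add: left_perp_def)

text \<open>
  Torsion classes strictly below \<open>T(B)\<close> are contained in \<open>\<^sup>\<bottom>B\<close>, and so is their join, which
  therefore does not contain \<open>B\<close>.  Conversely,
  every torsion class is the join of the classes \<open>T(B)\<close> of its bricks, because bricks detect
  inclusions.
\<close>

lemma JIc_tors: "JIc (tors K A) = generated_torsion_class ` {B \<in> mod_cat K A. is_brick A B}"
proof (intro equalityI subsetI)
  fix \<J> assume "\<J> \<in> generated_torsion_class ` {B \<in> mod_cat K A. is_brick A B}"
  then obtain B where B: "is_brick A B" "B \<in> mod_cat K A" and J: "\<J> = generated_torsion_class B"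
    by blast
  have "\<J> \<noteq> \<Squnion>\<^bsub>tors K A\<^esub> S" if S: "S \<subseteq> {\<T> \<in> carrier (tors K A). \<T> \<sqsubset>\<^bsub>tors K A\<^esub> \<J>}" for S
  proof -
    have tc: "torsion_class K A \<T>" and sub: "\<T> \<subseteq> left_perp B" if "\<T> \<in> S" for \<T>
    proof -
      show t: "torsion_class K A \<T>"
        using S that by auto
      have "\<T> \<subset> \<J>"
        using S that by auto
      then show "\<T> \<subseteq> left_perp B"
        using proper_subclass_of_generated[OF B t] J by simp
    qed
    have "\<Squnion>\<^bsub>tors K A\<^esub> S \<subseteq> left_perp B"
      by (rule sup_tors_least[OF tc torsion_class_left_perp[OF B(2)] sub])
    then show ?thesis
      using mem_generated[OF B(2)] brick_not_in_left_perp[OF B] J by blast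
  qed
  \<comment> \<open>The empty join is the case \<open>S = {}\<close> of the second condition.\<close>
  from this this[of "{}"] show "\<J> \<in> JIc (tors K A)"
    using torsion_class_generated[OF B(2)] J by (simp add: JIc_def)
next
  fix \<J> assume "\<J> \<in> JIc (tors K A)"
  then have J: "torsion_class K A \<J>"
    and irr: "\<And>S. S \<subseteq> {\<T> \<in> carrier (tors K A). \<T> \<sqsubset>\<^bsub>tors K A\<^esub> \<J>} \<Longrightarrow> \<J> \<noteq> \<Squnion>\<^bsub>tors K A\<^esub> S"
    by (auto simp: JIc_def)
  show "\<J> \<in> generated_torsion_class ` {B \<in> mod_cat K A. is_brick A B}"
  proof (rule ccontr)
    assume nJ: "\<not> ?thesis"
    define S where "S = generated_torsion_class ` {B \<in> \<J>. is_brick A B}"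
    have gen: "torsion_class K A (generated_torsion_class B)" "B \<in> generated_torsion_class B"
      "generated_torsion_class B \<subset> \<J>" if "B \<in> \<J>" "is_brick A B" for B
    proof -
      have Bm: "B \<in> mod_cat K A"
        using that(1) torsion_class_subset[OF J] by blast
      show "torsion_class K A (generated_torsion_class B)" "B \<in> generated_torsion_class B"
        using torsion_class_generated[OF Bm] mem_generated[OF Bm] .
      show "generated_torsion_class B \<subset> \<J>"
        using generated_subset_iff[OF Bm J] that nJ Bm by blast
    qed
    then have tc: "torsion_class K A \<T>" if "\<T> \<in> S" for \<T>
      using that by (auto simp: S_def)
    have sub: "\<T> \<subset> \<J>" if "\<T> \<in> S" for \<T>
      using that gen(3) by (auto simp: S_def)
    have "\<Squnion>\<^bsub>tors K A\<^esub> S \<subseteq> \<J>"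
      by (rule sup_tors_least[OF tc J]) (use sub in blast)+
    moreover have "\<J> \<subseteq> \<Squnion>\<^bsub>tors K A\<^esub> S"
    proof (rule ccontr)
      have sup: "torsion_class K A (\<Squnion>\<^bsub>tors K A\<^esub> S)"
        by (rule torsion_class_sup) (rule tc)
      assume "\<not> \<J> \<subseteq> \<Squnion>\<^bsub>tors K A\<^esub> S"
      then obtain B where B: "is_brick A B" "B \<in> \<J>" "B \<in> right_perp K A (\<Squnion>\<^bsub>tors K A\<^esub> S)"
        by (rule brick_of_not_subset[OF J sup])
      have "generated_torsion_class B \<subseteq> \<Squnion>\<^bsub>tors K A\<^esub> S"
        by (rule sup_tors_upper[OF tc]) (use B in \<open>auto simp: S_def\<close>)
      then have "B \<in> \<Squnion>\<^bsub>tors K A\<^esub> S"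
        using gen(2)[OF B(2,1)] by blast
      then show False
        using brick_not_in_torsion_and_right_perp[OF sup B(1)] B(3) by simp
    qed
    moreover have "S \<subseteq> {\<T> \<in> carrier (tors K A). \<T> \<sqsubset>\<^bsub>tors K A\<^esub> \<J>}"
      using tc sub by auto
    ultimately show False
      using irr by blast
  qed
qed

lemma lower_star_generated:
  assumes B: "is_brick A B" "B \<in> mod_cat K A"
  shows "lower_star (tors K A) (generated_torsion_class B) = generated_torsion_class B \<inter> left_perp B"
proof -
  let ?J = "generated_torsion_class B"
  define S where "S = {\<T> \<in> carrier (tors K A). \<T> \<sqsubset>\<^bsub>tors K A\<^esub> ?J}"
  note J = torsion_class_generated[OF B(2)] and P = torsion_class_left_perp[OF B(2)]
  have tc: "torsion_class K A \<T>" if "\<T> \<in> S" for \<T>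
    using that by (simp add: S_def)
  have sub: "\<T> \<subseteq> ?J \<inter> left_perp B" if "\<T> \<in> S" for \<T>
    using that proper_subclass_of_generated[OF B, of \<T>] by (auto simp: S_def)
  have "?J \<inter> left_perp B \<subset> ?J"
    using mem_generated[OF B(2)] brick_not_in_left_perp[OF B] by blast
  then have "?J \<inter> left_perp B \<in> S"
    using torsion_class_Int[OF J P] by (simp add: S_def)
  then have "\<Squnion>\<^bsub>tors K A\<^esub> S = ?J \<inter> left_perp B"
    by (intro equalityI sup_tors_least[OF tc torsion_class_Int[OF J P] sub] sup_tors_upper[OF tc])
  then show ?thesis
    by (simp add: lower_star_def S_def)
qed

text \<open>
  If \<open>\<T>\<close> meets \<open>T(B)\<close> in \<open>T(B) \<inter> \<^sup>\<bottom>B\<close>, then \<open>\<T> \<subseteq> \<^sup>\<bottom>B\<close>: otherwise \<open>B\<close> is an extension of some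
  \<open>Q \<in> \<^sup>\<bottom>B\<close> by some \<open>N \<in> \<T>\<close>; as a quotient of \<open>B\<close> in \<open>\<^sup>\<bottom>B\<close>, the module \<open>Q\<close> belongs to \<open>\<T>\<close> too, and
  then so does \<open>B\<close>.
\<close>

lemma kappa_generated:
  assumes B: "is_brick A B" "B \<in> mod_cat K A"
  shows "kappa (tors K A) (generated_torsion_class B) = left_perp B"
proof -
  let ?J = "generated_torsion_class B"
  note J = torsion_class_generated[OF B(2)] and P = torsion_class_left_perp[OF B(2)]
  define S where "S = {\<T> \<in> carrier (tors K A).
    \<T> \<sqinter>\<^bsub>tors K A\<^esub> ?J = lower_star (tors K A) ?J}"
  have S: "\<T> \<in> S \<longleftrightarrow> torsion_class K A \<T> \<and> \<T> \<inter> ?J = ?J \<inter> left_perp B" for \<T>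
    using meet_tors[OF _ J] lower_star_generated[OF B] by (auto simp: S_def)
  have "left_perp B \<in> S"
    using P S by blast
  moreover have "\<T> \<subseteq> left_perp B" if "\<T> \<in> S" for \<T>
  proof
    fix X assume X: "X \<in> \<T>"
    have T: "torsion_class K A \<T>" and TJ: "\<T> \<inter> ?J = ?J \<inter> left_perp B"
      using that S by auto
    have "orthogonal A X B"
    proof (rule ccontr)
      assume o: "\<not> orthogonal A X B"
      obtain N Q i q where N: "N \<in> \<T>" and Q: "Q \<in> left_perp B" and se: "short_exact A N i B q Q"
        by (rule brick_extension_of_torsion[OF B T X o])
      have "Q \<in> ?J"
        using torsion_class_quotient[OF J mem_generated[OF B(2)], of Q q] Q se
        by (simp add: short_exact_def left_perp_def)
      then have "Q \<in> \<T>"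
        using TJ Q by blast
      then have "B \<in> \<T>"
        using torsion_class_extension[OF T N _ B(2) se] by blast
      then show False
        using TJ mem_generated[OF B(2)] brick_not_in_left_perp[OF B] by blast
    qed
    then show "X \<in> left_perp B"
      using X torsion_class_subset[OF T] by (auto simp: left_perp_def)
  qed
  ultimately have gr: "greatest (tors K A) (left_perp B) S"
    by (auto simp: greatest_def S_def)
  moreover have "\<T> = left_perp B" if "greatest (tors K A) \<T> S" for \<T>
    using that gr by (auto simp: greatest_def)
  ultimately have "(THE \<T>. greatest (tors K A) \<T> S) = left_perp B"
    by (rule the_equality)
  then show ?thesis
    by (simp add: kappa_def S_def)
qed

text \<open>
  A torsion class strictly above \<open>\<^sup>\<bottom>B\<close> contains \<open>B\<close>, as \<open>B\<close> is an extension of a member of \<open>\<^sup>\<bottom>B\<close> by a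
  member of this class; so does every intersection of such classes.  Conversely, \<open>\<M>\<close> is the
  intersection of the classes \<open>\<^sup>\<bottom>B\<close> for the bricks \<open>B\<close> in \<open>\<M>\<^sup>\<bottom>\<close>, because a module outside \<open>\<M>\<close> has
  such a brick as a quotient.
\<close>

lemma MIc_tors: "MIc (tors K A) = left_perp ` {B \<in> mod_cat K A. is_brick A B}"
proof (intro equalityI subsetI)
  fix \<M> assume "\<M> \<in> left_perp ` {B \<in> mod_cat K A. is_brick A B}"
  then obtain B where B: "is_brick A B" "B \<in> mod_cat K A" and M: "\<M> = left_perp B"
    by blast
  note P = torsion_class_left_perp[OF B(2)]
  have "\<M> \<noteq> \<Sqinter>\<^bsub>tors K A\<^esub> S" if S: "S \<subseteq> {\<T> \<in> carrier (tors K A). \<M> \<sqsubset>\<^bsub>tors K A\<^esub> \<T>}" for S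
  proof -
    have tc: "torsion_class K A \<T>" if "\<T> \<in> S" for \<T>
      using S that by auto
    have "B \<in> \<T>" if "\<T> \<in> S" for \<T>
    proof -
      have sub: "left_perp B \<subset> \<T>"
        using S that M by auto
      note T = tc[OF that]
      obtain X where X: "X \<in> \<T>" "X \<notin> left_perp B"
        using sub by blast
      then have o: "\<not> orthogonal A X B"
        using torsion_class_subset[OF T] by (auto simp: left_perp_def)
      obtain N Q i q where "N \<in> \<T>" "Q \<in> left_perp B" "short_exact A N i B q Q"
        by (rule brick_extension_of_torsion[OF B T X(1) o])
      then show ?thesis
        using torsion_class_extension[OF T _ _ B(2)] sub by blast
    qed
    moreover have "\<Sqinter>\<^bsub>tors K A\<^esub> S = mod_cat K A \<inter> \<Inter>S"
      by (rule inf_tors) (rule tc)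
    ultimately have "B \<in> \<Sqinter>\<^bsub>tors K A\<^esub> S"
      using B(2) by blast
    then show ?thesis
      using brick_not_in_left_perp[OF B] M by blast
  qed
  \<comment> \<open>Likewise for the empty meet.\<close>
  from this this[of "{}"] show "\<M> \<in> MIc (tors K A)"
    using P M by (simp add: MIc_def)
next
  fix \<M> assume "\<M> \<in> MIc (tors K A)"
  then have M: "torsion_class K A \<M>"
    and irr: "\<And>S. S \<subseteq> {\<T> \<in> carrier (tors K A). \<M> \<sqsubset>\<^bsub>tors K A\<^esub> \<T>} \<Longrightarrow> \<M> \<noteq> \<Sqinter>\<^bsub>tors K A\<^esub> S"
    by (auto simp: MIc_def)
  show "\<M> \<in> left_perp ` {B \<in> mod_cat K A. is_brick A B}"
  proof (rule ccontr)
    assume nM: "\<not> ?thesis"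
    define S where "S = left_perp ` {B \<in> right_perp K A \<M>. is_brick A B}"
    have S: "torsion_class K A \<T> \<and> \<M> \<subset> \<T>" if TS: "\<T> \<in> S" for \<T>
    proof -
      obtain B where B: "B \<in> right_perp K A \<M>" "is_brick A B" "\<T> = left_perp B"
        using TS by (auto simp: S_def)
      have Bm: "B \<in> mod_cat K A"
        using B(1) by (simp add: right_perp_def)
      have "\<M> \<subseteq> left_perp B"
        using B(1) right_perp_iff_left_perp[OF M Bm] by simp
      moreover have "\<M> \<noteq> left_perp B"
        using nM Bm B(2) by blast
      ultimately show ?thesis
        using torsion_class_left_perp[OF Bm] B(3) by blast
    qed
    then have tc: "torsion_class K A \<T>" if "\<T> \<in> S" for \<T>
      using that by blast
    have inf: "\<Sqinter>\<^bsub>tors K A\<^esub> S = mod_cat K A \<inter> \<Inter>S"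
      by (rule inf_tors) (rule tc)
    have "\<Sqinter>\<^bsub>tors K A\<^esub> S \<subseteq> \<M>"
    proof
      fix X assume "X \<in> \<Sqinter>\<^bsub>tors K A\<^esub> S"
      then have X: "X \<in> mod_cat K A" "\<And>\<T>. \<T> \<in> S \<Longrightarrow> X \<in> \<T>"
        using inf by auto
      show "X \<in> \<M>"
      proof (rule ccontr)
        assume "X \<notin> \<M>"
        then obtain B where "is_brick A B" "B \<in> right_perp K A \<M>" "X \<notin> left_perp B"
          by (rule brick_quotient_of_not_mem[OF M X(1)])
        then show False
          using X(2) by (auto simp: S_def)
      qed
    qed
    moreover have "\<M> \<subseteq> \<Sqinter>\<^bsub>tors K A\<^esub> S"
      using inf torsion_class_subset[OF M] S by blast
    moreover have "S \<subseteq> {\<T> \<in> carrier (tors K A). \<M> \<sqsubset>\<^bsub>tors K A\<^esub> \<T>}"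
      using S by auto
    ultimately show False
      using irr by blast
  qed
qed

section \<open>Cover relations and extremality\<close>

text \<open>
  If \<open>B\<close> is a brick in \<open>C = \<U> \<inter> \<T>\<^sup>\<bottom>\<close>, then \<open>\<T> \<squnion> T(B) = \<U>\<close> because \<open>\<U>\<close> covers \<open>\<T>\<close>.  So
  \<open>Hom(B, B') = 0\<close> is impossible for two bricks in \<open>C\<close>: it would put \<open>\<U>\<close>, and with it \<open>B'\<close>, into \<open>\<^sup>\<bottom>B'\<close>.
  Let \<open>S\<close> be a brick of least dimension among the nonzero modules in \<open>C\<close>.  Images of homomorphisms
  between members of \<open>C\<close> are in \<open>C\<close>, so nonzero homomorphisms \<open>f: S \<rightarrow> B\<close> are injective and nonzero
  homomorphisms \<open>g: B \<rightarrow> S\<close> are surjective.  Then \<open>f \<circ> g\<close> is a nonzero endomorphism of \<open>B\<close>, hence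
  surjective, and \<open>f\<close> is an isomorphism.
\<close>

lemma brick_of_cover_unique:
  assumes T: "torsion_class K A \<T>" and U: "torsion_class K A \<U>"
    and cov: "covers (tors K A) \<T> \<U>"
  shows "\<exists>S \<in> \<U> \<inter> right_perp K A \<T>. is_brick A S \<and>
    (\<forall>B \<in> \<U> \<inter> right_perp K A \<T>. is_brick A B \<longrightarrow> module_iso A S B)"
proof -
  have TU: "\<T> \<subset> \<U>"
    using cov by (simp add: covers_def)
  have cover: "\<V> = \<U>" if "torsion_class K A \<V>" "\<T> \<subset> \<V>" "\<V> \<subseteq> \<U>" for \<V>
  proof (rule ccontr)
    assume "\<V> \<noteq> \<U>"
    then have "\<V> \<subset> \<U>"
      using that(3) by (rule psubsetI[rotated])
    then have "\<exists>\<V> \<in> carrier (tors K A). \<T> \<sqsubset>\<^bsub>tors K A\<^esub> \<V> \<and> \<V> \<sqsubset>\<^bsub>tors K A\<^esub> \<U>"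
      by (intro bexI[of _ \<V>]) (simp_all add: that)
    then show False
      using cov unfolding covers_def by (elim conjE notE)
  qed
  define C where "C = \<U> \<inter> right_perp K A \<T>"
  have CU: "C \<subseteq> mod_cat K A"
    by (auto simp: C_def right_perp_def)
  have hom: "\<not> orthogonal A B B'" if B: "is_brick A B" "B \<in> C" and B': "is_brick A B'" "B' \<in> C"
    for B B'
  proof
    assume o: "orthogonal A B B'"
    have Bm: "B \<in> mod_cat K A" and Bm': "B' \<in> mod_cat K A"
      using B B' CU by auto
    note G = torsion_class_generated[OF Bm] and P = torsion_class_left_perp[OF Bm']
    let ?J = "\<T> \<squnion>\<^bsub>tors K A\<^esub> generated_torsion_class B"
    have "B \<in> ?J"
      using join_tors_right[OF T G] mem_generated[OF Bm] by blast
    moreover have "B \<notin> \<T>"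
      using brick_not_in_torsion_and_right_perp[OF T B(1)] B(2) by (auto simp: C_def)
    ultimately have "\<T> \<subset> ?J"
      using join_tors_left[OF T G] by blast
    moreover have "generated_torsion_class B \<subseteq> \<U>"
      using generated_subset_iff[OF Bm U] B(2) by (simp add: C_def)
    then have "?J \<subseteq> \<U>"
      using join_tors_least[OF T G U] TU by blast
    ultimately have "?J = \<U>"
      by (rule cover[OF torsion_class_join[OF T G]])
    moreover have "\<T> \<subseteq> left_perp B'"
      using B'(2) right_perp_iff_left_perp[OF T Bm'] by (simp add: C_def)
    moreover have "generated_torsion_class B \<subseteq> left_perp B'"
      using generated_subset_iff[OF Bm P] Bm o by (simp add: left_perp_def)
    ultimately have "\<U> \<subseteq> left_perp B'"
      using join_tors_least[OF T G P] by blast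
    then show False
      using B'(2) brick_not_in_left_perp[OF B'(1) Bm'] by (auto simp: C_def)
  qed
  have "\<not> \<U> \<subseteq> \<T>"
    using TU by blast
  then obtain B0 where B0: "is_brick A B0" "B0 \<in> C"
    using brick_of_not_subset[OF U T] unfolding C_def by blast
  have sub: "I \<in> C" if "X \<in> C" "Y \<in> C" "I \<in> mod_cat K A" "p \<in> Hom A X I"
    "p ` carrier X = carrier I" "i \<in> Hom A I Y" "inj_on i (carrier I)" for X Y I p i
    using that torsion_class_quotient[OF U] right_perp_sub[OF T] unfolding C_def by blast
  have nz: "carrier B \<noteq> {\<zero>\<^bsub>B\<^esub>}" if "is_brick A B" "B \<in> C" for B
    using that is_brick_iff[of A B] mod_catD CU by blast
  obtain S where S: "S \<in> C" "is_brick A S"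
    and min: "\<And>X. \<lbrakk>X \<in> C; carrier X \<noteq> {\<zero>\<^bsub>X\<^esub>}\<rbrakk> \<Longrightarrow> mdim S \<le> mdim X"
    by (rule brick_of_minimal_dimension[OF CU B0(2) nz[OF B0]]) (use sub in blast)+
  have Sm: "S \<in> mod_cat K A"
    using S CU by blast
  have "module_iso A S B" if B: "is_brick A B" "B \<in> C" for B
  proof -
    have Bm: "B \<in> mod_cat K A"
      using B CU by blast
    obtain f x where f: "f \<in> Hom A S B" and x: "x \<in> carrier S" "f x \<noteq> \<zero>\<^bsub>B\<^esub>"
      using hom[OF S(2,1) B] by (auto simp: orthogonal_def)
    obtain I i where I: "I \<in> mod_cat K A" "f \<in> Hom A S I" "f ` carrier S = carrier I"
      "i \<in> Hom A I B" "inj_on i (carrier I)" "\<zero>\<^bsub>I\<^esub> = \<zero>\<^bsub>B\<^esub>"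
      by (rule image_factorization[OF Sm Bm f]) blast
    have "carrier I \<noteq> {\<zero>\<^bsub>I\<^esub>}"
      using x I(3,6) by auto
    then have "mdim S \<le> mdim I"
      using min sub[OF S(1) B(2) I(1-5)] by blast
    then have inj: "inj_on f (carrier S)"
      using mdim_surj_less[OF Sm mod_catD[OF I(1)] I(2,3)] by fastforce
    obtain g y where g: "g \<in> Hom A B S" and y: "y \<in> carrier B" "g y \<noteq> \<zero>\<^bsub>S\<^esub>"
      using hom[OF B S(2,1)] by (auto simp: orthogonal_def)
    obtain J j where J: "J \<in> mod_cat K A" "g \<in> Hom A B J" "g ` carrier B = carrier J"
      "j \<in> Hom A J S" "inj_on j (carrier J)" "\<And>y. y \<in> carrier J \<Longrightarrow> j y = y" "\<zero>\<^bsub>J\<^esub> = \<zero>\<^bsub>S\<^esub>"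
      by (rule image_factorization[OF Bm Sm g]) blast
    have "carrier J \<noteq> {\<zero>\<^bsub>J\<^esub>}"
      using y J(3,7) by auto
    then have "mdim S \<le> mdim J"
      using min sub[OF B(2) S(1) J(1-5)] by blast
    then have "j ` carrier J = carrier S"
      using mdim_inj(2)[OF J(1) Sm J(4,5)] by fastforce
    then have gs: "g ` carrier B = carrier S"
      using J(3,6) by simp
    then have "x \<in> g ` carrier B"
      using x(1) by simp
    then obtain b where b: "b \<in> carrier B" "g b = x"
      by blast
    \<comment> \<open>\<open>f \<circ> g\<close> does not vanish at \<open>b\<close>.\<close>
    have "compose (carrier B) f g ` carrier B = carrier B"
      by (rule brick_endomorphism(2)[OF B(1) Bm Hom_compose[OF mod_catD[OF Bm] g f] b(1)])
        (use b x in \<open>simp add: compose_def\<close>)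
    then have "f ` carrier S = carrier B"
      by (simp add: compose_def gs[symmetric] image_image)
    then show ?thesis
      using f inj by (auto simp: module_iso_def bij_betw_def)
  qed
  then show ?thesis
    using S unfolding C_def by (intro bexI[of _ S] conjI ballI impI)
qed

lemma generated_and_left_perp_iso:
  assumes B: "B \<in> mod_cat K A" and S: "S \<in> mod_cat K A"
    and "module_iso A S B"
  shows "generated_torsion_class B = generated_torsion_class S" and "left_perp B = left_perp S"
proof -
  obtain f where f: "f \<in> Hom A S B" "bij_betw f (carrier S) (carrier B)"
    using assms(3) by (auto simp: module_iso_def)
  obtain g where g: "g \<in> Hom A B S" "bij_betw g (carrier B) (carrier S)"
    by (rule Hom_inverse[OF mod_catD[OF S] mod_catD[OF B] f])
  have iso: "module_iso A S B" "module_iso A B S"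
    using f g by (auto simp: module_iso_def)
  have "B \<in> \<T> \<longleftrightarrow> S \<in> \<T>" if "torsion_class K A \<T>" for \<T>
    using torsion_class_iso[OF that] iso B S by blast
  then have "{\<T>. torsion_class K A \<T> \<and> B \<in> \<T>} = {\<T>. torsion_class K A \<T> \<and> S \<in> \<T>}"
    by blast
  then show "generated_torsion_class B = generated_torsion_class S"
    by (simp add: generated_torsion_class_def)
  have "orthogonal A X B \<longleftrightarrow> orthogonal A X S" if "X \<in> mod_cat K A" for X
    using orthogonal_sub[OF mod_catD[OF that] mod_catD[OF B] mod_catD[OF S] g(1)]
      orthogonal_sub[OF mod_catD[OF that] mod_catD[OF S] mod_catD[OF B] f(1)] f(2) g(2)
    by (auto simp: bij_betw_def)
  then show "left_perp B = left_perp S"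
    by (auto simp: left_perp_def)
qed

text \<open>
  For brick-splitting \<open>\<T>\<close> and \<open>\<U>\<close>, not being in the class and being perpendicular to it are the same for
  a brick.  Therefore \<open>T(B)\<close> separates \<open>\<U>\<close> from \<open>\<T>\<close> iff \<open>\<^sup>\<bottom>B\<close> does, namely iff \<open>B\<close> lies in
  \<open>\<U> \<inter> \<T>\<^sup>\<bottom>\<close>.
\<close>

lemma brick_splitting_cover:
  assumes x: "brick_splitting K A \<T>" and y: "brick_splitting K A \<U>"
    and cov: "covers (tors K A) \<T> \<U>"
  shows "\<exists>j m. {j' \<in> JIc (tors K A). j' \<sqsubseteq>\<^bsub>tors K A\<^esub> \<U> \<and> \<not> j' \<sqsubseteq>\<^bsub>tors K A\<^esub> \<T>} = {j} \<and>
    {m' \<in> MIc (tors K A). \<T> \<sqsubseteq>\<^bsub>tors K A\<^esub> m' \<and> \<not> \<U> \<sqsubseteq>\<^bsub>tors K A\<^esub> m'} = {m} \<and>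
    kappa (tors K A) j = m"
proof -
  have T: "torsion_class K A \<T>" and U: "torsion_class K A \<U>"
    using x y by (auto simp: brick_splitting_def)
  obtain S where S: "is_brick A S" "S \<in> \<U>" "S \<in> right_perp K A \<T>"
    and uniq: "\<forall>B \<in> \<U> \<inter> right_perp K A \<T>. is_brick A B \<longrightarrow> module_iso A S B"
    using brick_of_cover_unique[OF T U cov] by (elim bexE conjE IntE)
  have Sm: "S \<in> mod_cat K A"
    using S(3) by (simp add: right_perp_def)
  have eq: "generated_torsion_class B = generated_torsion_class S \<and> left_perp B = left_perp S"
    if "is_brick A B" "B \<in> \<U>" "B \<in> right_perp K A \<T>" for B
  proof -
    have "B \<in> mod_cat K A" "module_iso A S B"
      using uniq that by (auto simp: right_perp_def)
    then show ?thesis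
      using generated_and_left_perp_iso[OF _ Sm] by blast
  qed
  have notin: "B \<notin> \<V> \<longleftrightarrow> B \<in> right_perp K A \<V>"
    if "B \<in> mod_cat K A" "is_brick A B" "brick_splitting K A \<V>" for B \<V>
    using that brick_not_in_torsion_and_right_perp[of \<V> B] by (auto simp: brick_splitting_def)
  have gen: "generated_torsion_class B \<subseteq> \<U> \<and> \<not> generated_torsion_class B \<subseteq> \<T> \<longleftrightarrow>
      B \<in> \<U> \<and> B \<in> right_perp K A \<T>" if "B \<in> mod_cat K A" "is_brick A B" for B
    using generated_subset_iff[OF that(1)] T U notin[OF that x] by simp
  have perp: "\<T> \<subseteq> left_perp B \<and> \<not> \<U> \<subseteq> left_perp B \<longleftrightarrow> B \<in> \<U> \<and> B \<in> right_perp K A \<T>"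
    if "B \<in> mod_cat K A" "is_brick A B" for B
    using right_perp_iff_left_perp[OF _ that(1)] T U notin[OF that y] by auto
  have "{j' \<in> JIc (tors K A). j' \<sqsubseteq>\<^bsub>tors K A\<^esub> \<U> \<and> \<not> j' \<sqsubseteq>\<^bsub>tors K A\<^esub> \<T>} =
    {generated_torsion_class S}"
    unfolding JIc_tors le_tors using gen eq S Sm by blast
  moreover have "{m' \<in> MIc (tors K A). \<T> \<sqsubseteq>\<^bsub>tors K A\<^esub> m' \<and> \<not> \<U> \<sqsubseteq>\<^bsub>tors K A\<^esub> m'} =
    {left_perp S}"
    unfolding MIc_tors le_tors using perp eq S Sm by blast
  ultimately show ?thesis
    using kappa_generated[OF S(1) Sm] by blast
qed

text \<open>
  For \<open>j = T(B)\<close> the condition reads: \<open>B \<in> \<T>\<close> or \<open>\<T> \<subseteq> \<^sup>\<bottom>B\<close>.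
\<close>

lemma brick_splitting_iff_kappa:
  assumes T: "torsion_class K A \<T>"
  shows "brick_splitting K A \<T> \<longleftrightarrow>
    (\<forall>j \<in> JIc (tors K A). \<not> j \<sqsubseteq>\<^bsub>tors K A\<^esub> \<T> \<longrightarrow> \<T> \<sqsubseteq>\<^bsub>tors K A\<^esub> kappa (tors K A) j)"
proof -
  have "(\<not> generated_torsion_class B \<subseteq> \<T> \<longrightarrow> \<T> \<subseteq> kappa (tors K A) (generated_torsion_class B)) \<longleftrightarrow>
    B \<in> \<T> \<or> B \<in> right_perp K A \<T>" if "B \<in> mod_cat K A" "is_brick A B" for B
    using generated_subset_iff[OF that(1) T] kappa_generated[OF that(2,1)]
      right_perp_iff_left_perp[OF T that(1)] by auto
  then show ?thesis
    unfolding JIc_tors le_tors brick_splitting_def using T by auto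
qed

lemma maximal_chain_torsion_class:
  "\<lbrakk>maximal_chain (tors K A) C; \<T> \<in> C\<rbrakk> \<Longrightarrow> torsion_class K A \<T>"
  by (auto simp: maximal_chain_def pred_on.maxchain_def pred_on.chain_def tors_def)

end

theorem theorem1p5:
  fixes K :: "('k, 'c) ring_scheme" and A :: "('k, 'a, 'd) module_scheme"
  assumes "fd_algebra K A" and "connected_algebra A"
  shows "(\<forall>\<T> \<in> carrier (tors K A).
            left_modular_element (tors K A) \<T> \<longleftrightarrow>
            successor_closed (brick_quiver K A) (bricks_in K A \<T>)) \<and>
         (left_modular (tors K A) \<longleftrightarrow>
            (\<exists>C. maximal_chain (tors K A) C \<and> (\<forall>\<T> \<in> C. brick_splitting K A \<T>))) \<and>
         (extremal (tors K A) \<longleftrightarrow>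
            (\<exists>C. maximal_chain (tors K A) C \<and> (\<forall>\<T> \<in> C. brick_splitting K A \<T>)))"
proof -
  interpret fd_algebra K A by fact
  have lm: "left_modular_element (tors K A) \<T> \<longleftrightarrow> brick_splitting K A \<T>" for \<T>
    using brick_splitting_left_modular left_modular_brick_splitting by blast
  have sc: "brick_splitting K A \<T> \<longleftrightarrow> successor_closed (brick_quiver K A) (bricks_in K A \<T>)"
    if "torsion_class K A \<T>" for \<T>
    using brick_splitting_successor_closed successor_closed_brick_splitting[OF that] by blast
  have "extremal (tors K A) \<longleftrightarrow>
      (\<exists>C. maximal_chain (tors K A) C \<and> (\<forall>\<T> \<in> C. brick_splitting K A \<T>))"
  proof
    assume "extremal (tors K A)"
    then obtain C where C: "maximal_chain (tors K A) C"
      and k: "\<forall>x \<in> C. \<forall>j \<in> JIc (tors K A). \<not> j \<sqsubseteq>\<^bsub>tors K A\<^esub> x \<longrightarrow>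
        x \<sqsubseteq>\<^bsub>tors K A\<^esub> kappa (tors K A) j"
      unfolding extremal_def by blast
    have "brick_splitting K A \<T>" if "\<T> \<in> C" for \<T>
      using k that brick_splitting_iff_kappa[OF maximal_chain_torsion_class[OF C that]] by blast
    then show "\<exists>C. maximal_chain (tors K A) C \<and> (\<forall>\<T> \<in> C. brick_splitting K A \<T>)"
      using C by blast
  next
    assume "\<exists>C. maximal_chain (tors K A) C \<and> (\<forall>\<T> \<in> C. brick_splitting K A \<T>)"
    then obtain C where C: "maximal_chain (tors K A) C" and b: "\<forall>\<T> \<in> C. brick_splitting K A \<T>"
      by blast
    show "extremal (tors K A)"
      unfolding extremal_def
    proof (rule exI[of _ C], intro conjI ballI C)
      fix x assume x: "x \<in> C"
      have kx: "\<forall>j \<in> JIc (tors K A). \<not> j \<sqsubseteq>\<^bsub>tors K A\<^esub> x \<longrightarrow> x \<sqsubseteq>\<^bsub>tors K A\<^esub> kappa (tors K A) j"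
        using brick_splitting_iff_kappa[OF maximal_chain_torsion_class[OF C x]] b x by blast
      show "\<not> j \<sqsubseteq>\<^bsub>tors K A\<^esub> x \<longrightarrow> x \<sqsubseteq>\<^bsub>tors K A\<^esub> kappa (tors K A) j" if "j \<in> JIc (tors K A)" for j
        by (rule bspec[OF kx that])
      show "covers (tors K A) x y \<longrightarrow> (\<exists>j m.
          {j' \<in> JIc (tors K A). j' \<sqsubseteq>\<^bsub>tors K A\<^esub> y \<and> \<not> j' \<sqsubseteq>\<^bsub>tors K A\<^esub> x} = {j} \<and>
          {m' \<in> MIc (tors K A). x \<sqsubseteq>\<^bsub>tors K A\<^esub> m' \<and> \<not> y \<sqsubseteq>\<^bsub>tors K A\<^esub> m'} = {m} \<and>
          kappa (tors K A) j = m)" if y: "y \<in> C" for y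
        by (rule impI, rule brick_splitting_cover[OF bspec[OF b x] bspec[OF b y]])
    qed
  qed
  then show ?thesis
    using lm sc by (simp add: left_modular_def)
qed

end
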